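(* Consider the perturbed derivative-free iteration $K_{s+1}=K_s-\eta G(K_s)+\eta E_s$, $K_0\in\mathcal K_{st}$, for the LQR problem described in the context, where the perturbations satisfy $\Vert E_s\Vert_F\le\delta$ for all $s$, for some $\delta>0$. Let $\epsilon>0$ be a given error tolerance such that $\epsilon\log(120\Delta_0/\epsilon)<12\Delta_0$. Let $\theta_0=\min\{1/(2\phi_0),\rho_0/\lambda_0\}$. (i) Suppose that $G(K_s)$ is the one-point estimate $G^1_r(K_s,D_s;x_0^{(s)})$, that $$\eta\le\min\Big\{\frac{\mu r^2\epsilon}{480\phi_0[20C_m\mathcal J(K_0)d]^2},\ \frac1{4\phi_0},\ \frac{\rho_0 r}{20C_m\mathcal J(K_0)d+\delta r}\Big\},$$ $$r\le\min\Big\{\frac{\mu\theta_0}{16\phi_0}\sqrt{\frac{\epsilon}{15}},\ \frac1{4\phi_0}\sqrt{\frac{\mu\epsilon}{15}},\ \rho_0,\ \frac{10\mathcal J(K_0)}{\lambda_0}\Big\},$$ and $$\delta\le\min\Big\{\frac{\mu\theta_0}{16}\sqrt{\frac{\epsilon}{15}},\ \frac12\sqrt{\frac{\mu\epsilon}{30}}\Big\}.$$ Then $\mathcal J(K_{T_s})-\mathcal J(K^* )<\epsilon$ with probability at least $3/4$, where $T_s=\frac{4}{\eta\mu}\log\big(\frac{120\Delta_0}{\epsilon}\big)$. (ii) Suppose that $G(K_s)$ is the two-point estimate $G^2_r(K_s,D_s;x_0^{(s)})$, that $$\eta\le\min\Big\{\frac{\mu\epsilon}{480\phi_0 d\lambda_0^2},\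 \frac1{4\phi_0},\ \frac{\rho_0}{d\lambda_0+\delta}\Big\},$$ $$r\le\min\Big\{\frac{\mu\theta_0}{16\phi_0}\sqrt{\frac{\epsilon}{15}},\ \frac1{4\phi_0}\sqrt{\frac{\mu\epsilon}{15}},\ \rho_0\Big\},$$ and $$\delta\le\min\Big\{\frac{\mu\theta_0}{16}\sqrt{\frac{\epsilon}{15}},\ \frac12\sqrt{\frac{\mu\epsilon}{30}}\Big\}.$$ Then $\mathcal J(K_{T_s})-\mathcal J(K^* )<\epsilon$ with probability at least $3/4$, where $T_s=\frac{4}{\eta\mu}\log\big(\frac{120\Delta_0}{\epsilon}\big)$.
   Context: **LQR problem.** Consider $x_{t+1}=Ax_t+Bu_t$, $x_t\in\mathbb R^n$, $u_t\in\mathbb R^m$, $x_0\sim\mathcal D$, with stage cost $c_t(x_t,u_t)=x_t^\top Qx_t+u_t^\top Ru_t$. Standing assumptions: $(A,B)$ is stabilizable, $Q$ is symmetric positive semidefinite, $R$ is symmetric positive definite, $(A,Q^{1/2})$ is detectable; for $v\sim\mathcal D$, $\mathbb E[v]=0$, $\mathbb E[vv^\top]=I_n$ and $\Vert v\Vert_2^2\le C_m$ almost surely, $C_m>0$ a constant. Let $\mathcal K_{st}=\{K\in\mathbb R^{m\times n}:\rho(A-BK)<1\}$ ($\rho$ = spectral radius). For $K\in\mathcal K_{st}$ and $u_t=-Kx_t$, let $\mathcal J(K;x_0)=\sum_{t\ge0}c_t(x_t,u_t)=x_0^\top P_Kx_0$, where $P_K=Q+K^\top RK+(A-BK)^\top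 P_K(A-BK)$, and $\mathcal J(K)=\mathbb E_{x_0\sim\mathcal D}[\mathcal J(K;x_0)]=\mathrm{Tr}(P_K)$. If $K\notin\mathcal K_{st}$, $\mathcal J(K)=+\infty$. $K^*$ is the unique minimizer of $\mathcal J$ over $\mathcal K_{st}$. $\Vert\cdot\Vert_F$ is the Frobenius norm. **Gradient estimates.** Let $d=mn$, $r>0$ (smoothing radius), and let $D$ be uniformly distributed on $\{D\in\mathbb R^{m\times n}:\Vert D\Vert_F=1\}$. One-point: $G^1_r(K,D;x_0)=\mathcal J(K+rD;x_0)\frac drD$. Two-point: $G^2_r(K,D;x_0)=[\mathcal J(K+rD;x_0)-\mathcal J(K-rD;x_0)]\frac d{2r}D$. **Algorithm.** Given $K_0\in\mathcal K_{st}$, stepsize $\eta>0$, radius $r>0$: at each iteration $s=0,1,\dots,T_s-1$, draw a fresh $x_0^{(s)}\sim\mathcal D$ and a fresh uniform direction $D_s$ (independent of each other and of the past), let $G(K_s)$ be the one-point or two-point estimate at $(K_s,D_s;x_0^{(s)})$, and set $K_{s+1}=K_s-\eta G(K_s)+\eta E_s$, where $E_s\in\mathbb R^{m\times n}$ is a (possibly random) perturbation. Once a cost value in this recursion is infinite, later iterates may be assigned by any measurable convention. The iteration number $T_s$ is understood to be a positive integer. **Constants.** $\Delta_0=\mathcal J(K_0)-\mathcal J(K^* )$ and $\mathcal G^0=\{K:\mathcal J(K)-\mathcal J(K^* )\le10\Delta_0\}$. For each $K\in\mathcal K_{st}$, fix positive scalars $\lambda_K,\widetilde\lambda_K,\zeta_K,\phi_K,\beta_K$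 (known to exist) such that: if $\Vert K'-K\Vert_F\le\zeta_K$ then $|\mathcal J(K')-\mathcal J(K)|\le\lambda_K\Vert K'-K\Vert_F$ and $|\mathcal J(K';x_0)-\mathcal J(K;x_0)|\le\widetilde\lambda_K\Vert K'-K\Vert_F$; if $\Vert K'-K\Vert_F\le\beta_K$ then $\Vert\nabla\mathcal J(K')-\nabla\mathcal J(K)\Vert_F\le\phi_K\Vert K'-K\Vert_F$. Let $\mu>0$ be a constant (known to exist) with $\mu(\mathcal J(K)-\mathcal J(K^* ))\le\Vert\nabla\mathcal J(K)\Vert_F^2$ for all $K\in\mathcal K_{st}$. Put $\phi_0=\sup_{K\in\mathcal G^0}\phi_K$, $\lambda_0=\sup_{K\in\mathcal G^0}\lambda_K$, $\rho_0=\inf_{K\in\mathcal G^0}\min\{\beta_K,\zeta_K\}$; the scalars are chosen so that $\phi_0,\lambda_0<\infty$ and $\rho_0>0$. Let $g_\infty=\sup_{K\in\mathcal G^0}\Vert G(K)\Vert_F$ (supremum also over almost all realizations of $D,x_0$) and $g_2=\sup_{K\in\mathcal G^0}\mathbb E[\Vert G(K)-\mathbb E[G(K)\mid K]\Vert_F^2]$. The constants are those from the literature, for which the following known bounds hold and may be used: for the one-point estimate, if $r\le\min\{10\mathcal J(K_0)/\lambda_0,\rho_0\}$ then $g_2\le[20C_m\mathcal J(K_0)d/r]^2$ and $g_\infty\le20C_m\mathcal J(K_0)d/r$; for the two-point estimate, if $r\le\rho_0$ then $g_2\le d\lambda_0^2$ and $g_\infty\le d\lambda_0$. *)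

theory Defs
  imports "HOL-Analysis.Analysis" "HOL-Probability.Probability"
begin

text \<open>
  Gains are matrices \<^typ>\<open>real^'n^'m\<close> (\<open>'m\<close> rows, \<open>'n\<close> columns). On this type \<^const>\<open>norm\<close> is the
  Frobenius norm and \<^const>\<open>inner\<close> is the Frobenius inner product.
\<close>

definition eigenvalues :: "real^'n^'n \<Rightarrow> complex set" where
  "eigenvalues M = {c. \<exists>v::complex^'n. v \<noteq> 0 \<and> map_matrix complex_of_real M *v v = c *s v}"

definition spectral_radius :: "real^'n^'n \<Rightarrow> real" where
  "spectral_radius M = Max (cmod ` eigenvalues M)"

definition pos_semidef :: "real^'n^'n \<Rightarrow> bool" where
  "pos_semidef M \<longleftrightarrow> transpose M = M \<and> (\<forall>x. x \<bullet> (M *v x) \<ge> 0)"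

definition pos_def :: "real^'n^'n \<Rightarrow> bool" where
  "pos_def M \<longleftrightarrow> transpose M = M \<and> (\<forall>x. x \<noteq> 0 \<longrightarrow> x \<bullet> (M *v x) > 0)"

definition psd_sqrt :: "real^'n^'n \<Rightarrow> real^'n^'n" where
  "psd_sqrt M = (THE S. pos_semidef S \<and> S ** S = M)"

definition stabilizing :: "real^'n^'n \<Rightarrow> real^'m^'n \<Rightarrow> (real^'n^'m) set" where
  "stabilizing A B = {K. spectral_radius (A - B ** K) < 1}"

definition stabilizable :: "real^'n^'n \<Rightarrow> real^'m^'n \<Rightarrow> bool" where
  "stabilizable A B \<longleftrightarrow> (\<exists>K::real^'n^'m. spectral_radius (A - B ** K) < 1)"

definition detectable :: "real^'n^'n \<Rightarrow> real^'n^'p \<Rightarrow> bool" where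
  "detectable A C \<longleftrightarrow> (\<exists>L::real^'p^'n. spectral_radius (A - L ** C) < 1)"

definition lqr_system ::
  "real^'n^'n \<Rightarrow> real^'m^'n \<Rightarrow> real^'n^'n \<Rightarrow> real^'m^'m \<Rightarrow> bool" where
  "lqr_system A B Q R \<longleftrightarrow>
     stabilizable A B \<and> pos_semidef Q \<and> pos_def R \<and> detectable A (psd_sqrt Q)"

definition initial_law :: "(real^'n) measure \<Rightarrow> real \<Rightarrow> bool" where
  "initial_law \<D> Cm \<longleftrightarrow>
     prob_space \<D> \<and> sets \<D> = sets borel \<and> Cm > 0 \<and>
     (AE v in \<D>. (norm v)\<^sup>2 \<le> Cm) \<and>
     (\<integral>v. v \<partial>\<D>) = 0 \<and>
     (\<forall>i j. (\<integral>v. v $ i * v $ j \<partial>\<D>) = (mat 1 :: real^'n^'n) $ i $ j)"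

primrec lqr_state ::
  "real^'n^'n \<Rightarrow> real^'m^'n \<Rightarrow> real^'n^'m \<Rightarrow> real^'n \<Rightarrow> nat \<Rightarrow> real^'n" where
  "lqr_state A B K x0 0 = x0"
| "lqr_state A B K x0 (Suc t) =
     A *v lqr_state A B K x0 t + B *v (- (K *v lqr_state A B K x0 t))"

definition stage_cost :: "real^'n^'n \<Rightarrow> real^'m^'m \<Rightarrow> real^'n \<Rightarrow> real^'m \<Rightarrow> real" where
  "stage_cost Q R x u = x \<bullet> (Q *v x) + u \<bullet> (R *v u)"

text \<open>
  The convention that the cost is infinite for a non-stabilizing gain is applied to the
  cost from a fixed initial state as well.
\<close>

definition traj_cost ::
  "real^'n^'n \<Rightarrow> real^'m^'n \<Rightarrow> real^'n^'n \<Rightarrow> real^'m^'m \<Rightarrow> real^'n^'m \<Rightarrow> real^'n \<Rightarrow> ereal" where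
  "traj_cost A B Q R K x0 =
     (if K \<in> stabilizing A B
      then (\<Sum>t. ereal (stage_cost Q R (lqr_state A B K x0 t) (- (K *v lqr_state A B K x0 t))))
      else \<infinity>)"

definition lqr_cost ::
  "real^'n^'n \<Rightarrow> real^'m^'n \<Rightarrow> real^'n^'n \<Rightarrow> real^'m^'m \<Rightarrow> (real^'n) measure \<Rightarrow>
   real^'n^'m \<Rightarrow> ereal" where
  "lqr_cost A B Q R \<D> K =
     (if K \<in> stabilizing A B
      then ereal (\<integral>x0. real_of_ereal (traj_cost A B Q R K x0) \<partial>\<D>)
      else \<infinity>)"

text \<open>Only meaningful where \<open>f\<close> is finite in a neighbourhood and differentiable.\<close>

definition gradient :: "('a::real_inner \<Rightarrow> ereal) \<Rightarrow> 'a \<Rightarrow> 'a" where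
  "gradient f x = (THE g. GDERIV (\<lambda>y. real_of_ereal (f y)) x :> g)"

text \<open>
  The uniform distribution on the unit sphere is the normalized cone measure: the law of \<open>U / \<parallel>U\<parallel>\<close>
  for \<open>U\<close> uniform in the unit ball.
\<close>

definition unif_sphere :: "'a::euclidean_space measure" where
  "unif_sphere = distr (uniform_measure lborel (ball 0 1)) borel sgn"

datatype estimator = One_Point | Two_Point

text \<open>
  In the following, \<open>F\<close> stands for the cost from a fixed initial state as a function of the gain
  and the state.  The gains at which an estimate evaluates \<open>F\<close> are its queries; the estimate is
  meaningful only if \<open>F\<close> is finite at all of them.
\<close>

fun queries :: "estimator \<Rightarrow> real \<Rightarrow> real^'n^'m \<Rightarrow> real^'n^'m \<Rightarrow> (real^'n^'m) set" where
  "queries One_Point r K D = {K + r *\<^sub>R D}"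
| "queries Two_Point r K D = {K + r *\<^sub>R D, K - r *\<^sub>R D}"

fun grad_est ::
  "estimator \<Rightarrow> (real^'n^'m \<Rightarrow> real^'n \<Rightarrow> ereal) \<Rightarrow> real \<Rightarrow>
   real^'n^'m \<Rightarrow> real^'n^'m \<Rightarrow> real^'n \<Rightarrow> real^'n^'m" where
  "grad_est One_Point F r K D x0 =
     (real_of_ereal (F (K + r *\<^sub>R D) x0) * (real (CARD('m) * CARD('n)) / r)) *\<^sub>R D"
| "grad_est Two_Point F r K D x0 =
     ((real_of_ereal (F (K + r *\<^sub>R D) x0) - real_of_ereal (F (K - r *\<^sub>R D) x0)) *
       (real (CARD('m) * CARD('n)) / (2 * r))) *\<^sub>R D"

definition est_sup ::
  "(real^'n^'m \<Rightarrow> real^'n^'m \<Rightarrow> real^'n \<Rightarrow> real^'n^'m) \<Rightarrow> (real^'n) measure \<Rightarrow>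
   (real^'n^'m) set \<Rightarrow> ereal" where
  "est_sup G \<D> S =
     (SUP K\<in>S. esssup (unif_sphere \<Otimes>\<^sub>M \<D>) (\<lambda>(D, x0). ereal (norm (G K D x0))))"

definition est_var ::
  "(real^'n^'m \<Rightarrow> real^'n^'m \<Rightarrow> real^'n \<Rightarrow> real^'n^'m) \<Rightarrow> (real^'n) measure \<Rightarrow>
   (real^'n^'m) set \<Rightarrow> ennreal" where
  "est_var G \<D> S =
     (SUP K\<in>S. \<integral>\<^sup>+(D, x0).
        ennreal ((norm (G K D x0 - (\<integral>(D', x0'). G K D' x0' \<partial>(unif_sphere \<Otimes>\<^sub>M \<D>))))\<^sup>2)
        \<partial>(unif_sphere \<Otimes>\<^sub>M \<D>))"

text \<open>
  Independence of two random variables via the generated sigma-algebras;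
  \<^const>\<open>prob_space.indep_var\<close> would force both to have the same value type.
\<close>

definition indep_rv ::
  "'w measure \<Rightarrow> 'a measure \<Rightarrow> ('w \<Rightarrow> 'a) \<Rightarrow> 'b measure \<Rightarrow> ('w \<Rightarrow> 'b) \<Rightarrow> bool" where
  "indep_rv M N Y N' Z \<longleftrightarrow>
     prob_space.indep_set M (sets (vimage_algebra (space M) Y N))
                            (sets (vimage_algebra (space M) Z N'))"

text \<open>
  The past of iteration \<open>s\<close> consists of the directions, initial states, perturbations and new iterates of the
  iterations before \<open>s\<close>.  The perturbation \<open>E s\<close> may depend on this past, on \<open>D s\<close>, on \<open>X s\<close> and
  on additional randomness.  The recursion is imposed only as long as all queried costs have
  been finite; afterwards the iterates are arbitrary random variables.
\<close>

definition perturbed_iteration ::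
  "'w measure \<Rightarrow> estimator \<Rightarrow> (real^'n^'m \<Rightarrow> real^'n \<Rightarrow> ereal) \<Rightarrow> (real^'n) measure \<Rightarrow>
   real \<Rightarrow> real \<Rightarrow> nat \<Rightarrow> real^'n^'m \<Rightarrow>
   (nat \<Rightarrow> 'w \<Rightarrow> real^'n^'m) \<Rightarrow> (nat \<Rightarrow> 'w \<Rightarrow> real^'n) \<Rightarrow> (nat \<Rightarrow> 'w \<Rightarrow> real^'n^'m) \<Rightarrow>
   (nat \<Rightarrow> 'w \<Rightarrow> real^'n^'m) \<Rightarrow> bool" where
  "perturbed_iteration M est F \<D> \<eta> r T K0 D X E K \<longleftrightarrow>
     prob_space M \<and>
     (\<forall>s<T. D s \<in> borel_measurable M \<and> X s \<in> borel_measurable M \<and> E s \<in> borel_measurable M) \<and>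
     (\<forall>s\<le>T. K s \<in> borel_measurable M) \<and>
     (\<forall>s<T. distr M borel (D s) = unif_sphere \<and> distr M borel (X s) = \<D>) \<and>
     (\<forall>s<T. indep_rv M borel (D s) borel (X s)) \<and>
     (\<forall>s<T. indep_rv M
        (Pi\<^sub>M {..<s} (\<lambda>_. borel)) (\<lambda>\<omega>. \<lambda>j\<in>{..<s}. (D j \<omega>, X j \<omega>, E j \<omega>, K (Suc j) \<omega>))
        borel (\<lambda>\<omega>. (D s \<omega>, X s \<omega>))) \<and>
     (\<forall>\<omega>\<in>space M. K 0 \<omega> = K0) \<and>
     (\<forall>s<T. AE \<omega> in M.
        (\<forall>j\<le>s. \<forall>P\<in>queries est r (K j \<omega>) (D j \<omega>). F P (X j \<omega>) \<noteq> \<infinity>) \<longrightarrow>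
        K (Suc s) \<omega> =
          K s \<omega> - \<eta> *\<^sub>R grad_est est F r (K s \<omega>) (D s \<omega>) (X s \<omega>) + \<eta> *\<^sub>R E s \<omega>)"

end

theory Submission
  imports Defs "HOL-Computational_Algebra.Fundamental_Theorem_Algebra"
begin

text \<open>
  A gain leaves the sublevel set \<open>G0\<close> only with small probability: with \<open>\<Delta> s\<close> the optimality gap at
  step \<open>s\<close>, restricted to the event that the iterates have remained in \<open>G0\<close>, smoothness and gradient
  domination give \<open>E (\<Delta> (s + 1)) + 10 \<Delta>0 Pr (exit at s + 1) \<le> (1 - \<eta> \<mu> / 2) E (\<Delta> s) + c\<close>, where \<open>c\<close>
  collects bias, variance and perturbation and is at most \<open>7/480 \<eta> \<mu> \<epsilon>\<close>. Summing bounds the exit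
  probability by \<open>1/10 + T c / (10 \<Delta>0)\<close>, and iterating with Markov's inequality bounds the
  probability of a gap of at least \<open>\<epsilon>\<close> at time \<open>T\<close>.

  The bias of the gradient estimates is at most \<open>\<phi>0 r\<close> by a reflection argument on the sphere, and
  the cost is differentiable because \<open>P\<^sub>K\<close> solves a Lyapunov equation whose operator is invertible
  for stabilizing gains.
\<close>

section \<open>Orbits under matrices of spectral radius less than one\<close>

text \<open>Smoothness, bias and noise bounds are available only on \<open>G0\<close>, and nothing
  keeps an iterate there with certainty. An iterate that leaves \<open>G0\<close> for another
  stabilizing gain has a gap above \<open>10 * \<Delta>0\<close>, and this amount is what the
  one-step inequality charges to the exit. \<open>E s\<close> may depend on the draw of its own
  step, so it cannot be averaged out; it is treated like the bias, as an error of bounded norm, and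
  only the difference between an estimate and its mean is integrated. The share 7/480 consists of
  6/480 for bias and perturbation and 1/480 for the variance. The exit bound grows linearly in
  \<open>T\<close>, and this is where the tolerance condition enters: with
  \<open>\<eta> * \<mu> * T = 4 * ln (120 * \<Delta>0 / \<epsilon>)\<close> it makes
  \<open>T * c\<close> at most 7/10 of \<open>\<Delta>0\<close>. Exit then has probability at most
  17/100 and a gap of at least \<open>\<epsilon>\<close> without exit at most 9/240, together below
  1/4.\<close>

lemma ex_real_poly_relation:
  fixes f :: "nat \<Rightarrow> 'a::euclidean_space"
  shows "\<exists>p::real poly. p \<noteq> 0 \<and> (\<Sum>i\<le>degree p. coeff p i *\<^sub>R f i) = 0"
proof -
  define N where "N = DIM('a)"
  have "\<exists>c. (\<exists>i\<le>N. c i \<noteq> 0) \<and> (\<Sum>i\<le>N. c i *\<^sub>R f i) = 0"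
  proof (cases "inj_on f {..N}")
    case True
    then have "card (f ` {..N}) > DIM('a)" by (simp add: card_image N_def)
    then have "dependent (f ` {..N})" by (intro dependent_biggerset) auto
    then obtain u where u: "\<exists>v\<in>f ` {..N}. u v \<noteq> 0" "(\<Sum>v\<in>f ` {..N}. u v *\<^sub>R v) = 0"
      by (auto simp: real_vector.dependent_finite)
    have "(\<Sum>i\<le>N. u (f i) *\<^sub>R f i) = 0"
      using u(2) True by (simp add: sum.reindex)
    with u(1) show ?thesis by (intro exI[of _ "\<lambda>i. u (f i)"]) auto
  next
    \<comment> \<open>A coincidence \<open>f i = f j\<close> may leave the set of values
      independent, so here the relation is \<open>f i - f j = 0\<close>.\<close>
    case False
    then obtain i j where ij: "i \<le> N" "j \<le> N" "i \<noteq> j" "f i = f j"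
      by (auto simp: inj_on_def)
    define c where "c k = (if k = i then 1 else if k = j then - 1 else (0::real))" for k
    have "(\<Sum>k\<le>N. c k *\<^sub>R f k) = (\<Sum>k\<in>{i,j}. c k *\<^sub>R f k)"
      using ij by (intro sum.mono_neutral_right) (auto simp: c_def)
    also have "\<dots> = 0" using ij by (simp add: c_def)
    finally show ?thesis using ij(1) by (intro exI[of _ c]) (auto simp: c_def)
  qed
  then obtain c where c: "\<exists>i\<le>N. c i \<noteq> 0" "(\<Sum>i\<le>N. c i *\<^sub>R f i) = 0" by blast
  define p where "p = (\<Sum>i\<le>N. monom (c i) i)"
  have cf: "coeff p k = (if k \<le> N then c k else 0)" for k
    by (simp add: p_def coeff_sum)
  have "p \<noteq> 0" using c(1) cf by (metis coeff_0)
  moreover have deg: "degree p \<le> N" by (intro degree_le) (simp add: cf)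
  have "(\<Sum>i\<le>degree p. coeff p i *\<^sub>R f i) = (\<Sum>i\<le>N. coeff p i *\<^sub>R f i)"
    using deg by (intro sum.mono_neutral_left) (auto simp: coeff_eq_0)
  then have "(\<Sum>i\<le>degree p. coeff p i *\<^sub>R f i) = 0" using c(2) by (simp add: cf)
  ultimately show ?thesis by blast
qed

text \<open>Summing the recursion bounds the next partial sum by
  \<open>y 0 + a * (\<Sum>t<n. y t) + suminf w\<close>; the bound
  \<open>(y 0 + suminf w) / (1 - a)\<close> is the fixed point of this map and hence
  invariant.\<close>

lemma summable_of_contraction:
  fixes y w :: "nat \<Rightarrow> real"
  assumes "\<And>t. y t \<ge> 0" "\<And>t. y (Suc t) \<le> a * y t + w t" "0 \<le> a" "a < 1"
    "\<And>t. w t \<ge> 0" "summable w"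
  shows "summable y"
proof (rule summableI_nonneg_bounded[where x = "(y 0 + suminf w) / (1 - a)"])
  define B where "B = (y 0 + suminf w) / (1 - a)"
  fix n
  have "(\<Sum>t<n. y t) \<le> B"
  proof (induction n)
    case 0
    show ?case using assms by (auto simp: B_def intro!: divide_nonneg_nonneg add_nonneg_nonneg suminf_nonneg)
  next
    case (Suc n)
    have "(\<Sum>t<Suc n. y t) = y 0 + (\<Sum>t<n. y (Suc t))" by (rule sum.lessThan_Suc_shift)
    also have "(\<Sum>t<n. y (Suc t)) \<le> (\<Sum>t<n. a * y t + w t)" using assms(2) by (rule sum_mono)
    also have "\<dots> = a * (\<Sum>t<n. y t) + (\<Sum>t<n. w t)"
      by (simp add: sum.distrib sum_distrib_left)
    also have "(\<Sum>t<n. w t) \<le> suminf w" using assms by (intro sum_le_suminf) auto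
    also have "a * (\<Sum>t<n. y t) \<le> a * B" using Suc assms by (intro mult_left_mono) auto
    finally have "(\<Sum>t<Suc n. y t) \<le> y 0 + (a * B + suminf w)" by linarith
    also have "\<dots> = B" using assms(4) by (simp add: B_def field_simps)
    finally show ?case .
  qed
  then show "(\<Sum>t<n. y t) \<le> (y 0 + suminf w) / (1 - a)" by (simp add: B_def)
qed (use assms in auto)

text \<open>This is p(C) v, written through the orbit of \<open>v\<close> so that the algebra of
  \<open>p\<close> acts on vectors and no polynomial in matrices has to be formed.\<close>

definition poly_orbit :: "complex^'n^'n \<Rightarrow> complex poly \<Rightarrow> complex^'n \<Rightarrow> complex^'n" where
  "poly_orbit C p v = (\<Sum>i\<le>degree p. coeff p i *s (((*v) C) ^^ i) v)"

lemma poly_orbit_eq: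
  assumes "degree p \<le> N"
  shows "poly_orbit C p v = (\<Sum>i\<le>N. coeff p i *s (((*v) C) ^^ i) v)"
  unfolding poly_orbit_def using assms
  by (intro sum.mono_neutral_left) (auto simp: coeff_eq_0)

lemma matrix_vector_mult_sum_right:
  fixes C :: "'a::field^'n^'m"
  shows "C *v (\<Sum>i\<in>I. f i) = (\<Sum>i\<in>I. C *v f i)"
  using vec.linear_sum[OF matrix_vector_mul_linear_gen] .

lemma sum_matrix_vector_mult:
  fixes f :: "'i \<Rightarrow> 'a::comm_semiring_1^'n^'m"
  shows "(\<Sum>i\<in>I. f i) *v v = (\<Sum>i\<in>I. f i *v v)"
  by (induction I rule: infinite_finite_induct) (auto simp: matrix_vector_mult_add_rdistrib)

lemma poly_orbit_add: "poly_orbit C (p + q) v = poly_orbit C p v + poly_orbit C q v"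
proof -
  let ?N = "max (degree p) (degree q)"
  have "degree (p + q) \<le> ?N" by (rule degree_add_le_max)
  then show ?thesis
    by (simp add: poly_orbit_eq[where N = ?N] vector_sadd_rdistrib sum.distrib)
qed

lemma poly_orbit_smult: "poly_orbit C (smult a p) v = a *s poly_orbit C p v"
  by (simp add: poly_orbit_eq[where N = "degree p"] degree_smult_le vec.scale_sum_right
      vector_smult_assoc)

lemma poly_orbit_pCons_0: "poly_orbit C (pCons 0 p) v = C *v poly_orbit C p v"
proof -
  have "poly_orbit C (pCons 0 p) v = (\<Sum>i\<le>degree p. coeff p i *s (((*v) C) ^^ Suc i) v)"
    by (subst poly_orbit_eq[where N = "Suc (degree p)"])
      (auto simp: degree_pCons_le sum.atMost_Suc_shift simp del: sum.atMost_Suc)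
  also have "\<dots> = C *v poly_orbit C p v"
    by (simp add: poly_orbit_def matrix_vector_mult_sum_right vector_scalar_commute)
  finally show ?thesis .
qed

lemma funpow_mult_vec_diff_scale:
  fixes C :: "'a::field^'n^'n"
  shows "(((*v) C) ^^ i) (x - c *s y) = (((*v) C) ^^ i) x - c *s (((*v) C) ^^ i) y"
  by (induction i) (auto simp: matrix_vector_mult_diff_distrib vector_scalar_commute)

lemma poly_orbit_diff_scale:
  "poly_orbit C p (x - c *s y) = poly_orbit C p x - c *s poly_orbit C p y"
  by (simp add: poly_orbit_def funpow_mult_vec_diff_scale vector_ssub_ldistrib sum_subtractf
      vec.scale_sum_right vector_smult_assoc mult.commute)

lemma poly_orbit_mult_vec: "poly_orbit C p (C *v v) = C *v poly_orbit C p v"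
  by (simp add: poly_orbit_def matrix_vector_mult_sum_right vector_scalar_commute
      funpow_swap1)

lemma poly_orbit_linear_factor:
  "poly_orbit C ([:-c, 1:] * q) v = C *v poly_orbit C q v - c *s poly_orbit C q v"
proof -
  have "[:-c, 1:] * q = smult (-c) q + pCons 0 q" by simp
  then show ?thesis
    by (simp only: poly_orbit_add poly_orbit_smult poly_orbit_pCons_0) (simp add: vec_eq_iff)
qed

lemma poly_orbit_eigenvector:
  assumes "C *v v = c *s v"
  shows "poly_orbit C p v = poly p c *s v"
proof -
  have "(((*v) C) ^^ i) v = c ^ i *s v" for i
    by (induction i) (auto simp: vector_scalar_commute assms vector_smult_assoc mult.commute)
  then show ?thesis
    by (simp add: poly_orbit_def poly_altdef vec.scale_sum_left vector_smult_assoc)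
qed

lemma norm_vector_scalar_mult:
  fixes c :: "'a::real_normed_div_algebra"
  shows "norm (c *s v) = norm c * norm v"
  by (simp add: norm_vec_def norm_mult L2_set_right_distrib)

text \<open>Takes the place of the Jordan form. The induction splits a root \<open>c\<close> off
  \<open>p\<close>. If \<open>c\<close> is an eigenvalue, \<open>C *v v - c *s v\<close> is
  annihilated by the cofactor, so its orbit is summable, and the orbit of \<open>v\<close> follows
  it through a recursion with factor \<open>c\<close>. Otherwise C - c is injective, and the
  cofactor already annihilates \<open>v\<close>.\<close>

lemma summable_orbit_if_annihilated:
  fixes C :: "complex^'n^'n"
  assumes eig: "\<And>c v. v \<noteq> 0 \<Longrightarrow> C *v v = c *s v \<Longrightarrow> cmod c < 1"
    and "p \<noteq> 0" "poly_orbit C p v = 0"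
  shows "summable (\<lambda>t. norm ((((*v) C) ^^ t) v))"
  using assms(2,3)
proof (induction "degree p" arbitrary: p v rule: less_induct)
  case less
  show ?case
  proof (cases "degree p = 0")
    case True
    then obtain a where a: "p = [:a:]" by (metis degree_eq_zeroE)
    with less have "v = 0" by (auto simp: poly_orbit_def)
    moreover have "(((*v) C) ^^ t) 0 = 0" for t by (induction t) auto
    ultimately show ?thesis by simp
  next
    case False
    then have "\<not> constant (poly p)" by (simp add: constant_degree)
    then obtain c where "poly p c = 0" using fundamental_theorem_of_algebra by blast
    then obtain q where q: "p = [:-c, 1:] * q" by (auto simp: poly_eq_0_iff_dvd)
    with less have "q \<noteq> 0" by auto
    then have deg: "degree q < degree p" unfolding q by (subst degree_mult_eq) auto
    show ?thesis
    proof (cases "\<exists>u. u \<noteq> 0 \<and> C *v u = c *s u")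
      case True
      then have c: "cmod c < 1" using eig by blast
      define w where "w = C *v v - c *s v"
      have "poly_orbit C q w = 0"
        using less q by (simp only: w_def poly_orbit_diff_scale poly_orbit_mult_vec
            poly_orbit_linear_factor)
      then have *: "summable (\<lambda>t. norm ((((*v) C) ^^ t) w))"
        using less deg \<open>q \<noteq> 0\<close> by blast
      have "(((*v) C) ^^ Suc t) v = c *s (((*v) C) ^^ t) v + (((*v) C) ^^ t) w" for t
        by (simp add: w_def funpow_mult_vec_diff_scale funpow_swap1)
      then have "norm ((((*v) C) ^^ Suc t) v)
          \<le> cmod c * norm ((((*v) C) ^^ t) v) + norm ((((*v) C) ^^ t) w)" for t
        by (metis norm_triangle_ineq norm_vector_scalar_mult)
      then show ?thesis
        by (intro summable_of_contraction[OF _ _ _ c _ *]) auto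
    next
      case False
      have "C *v poly_orbit C q v - c *s poly_orbit C q v = 0"
        using less q by (simp only: poly_orbit_linear_factor)
      with False have "poly_orbit C q v = 0" by auto
      then show ?thesis using less deg \<open>q \<noteq> 0\<close> by blast
    qed
  qed
qed

text \<open>The powers of \<open>C\<close> lie in a finite-dimensional real vector space of matrices
  and therefore satisfy a polynomial relation with real coefficients, which is then read over the
  complex numbers.\<close>

lemma ex_annihilating_poly:
  fixes C :: "complex^'n^'n"
  shows "\<exists>p. p \<noteq> 0 \<and> (\<forall>v. poly_orbit C p v = 0)"
proof -
  define f where "f i = (((**) C) ^^ i) (mat 1)" for i
  have f: "f i *v v = (((*v) C) ^^ i) v" for i v
    unfolding f_def by (induction i) (auto simp: matrix_vector_mul_assoc[symmetric])
  obtain p :: "real poly" where p: "p \<noteq> 0" "(\<Sum>i\<le>degree p. coeff p i *\<^sub>R f i) = 0"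
    using ex_real_poly_relation by blast
  define q where "q = map_poly complex_of_real p"
  have "q \<noteq> 0" "degree q = degree p" "coeff q i = of_real (coeff p i)" for i
    using p by (auto simp: q_def map_poly_eq_0_iff degree_map_poly coeff_map_poly)
  moreover have "poly_orbit C q v = 0" for v
  proof -
    have "poly_orbit C q v = (\<Sum>i\<le>degree p. (coeff p i *\<^sub>R f i) *v v)"
      by (auto simp: poly_orbit_def f[symmetric] calculation vec_eq_iff matrix_vector_mult_def
          scaleR_conv_of_real[symmetric] scaleR_sum_right intro!: sum.cong)
    also have "\<dots> = (\<Sum>i\<le>degree p. coeff p i *\<^sub>R f i) *v v"
      by (rule sum_matrix_vector_mult[symmetric])
    finally show ?thesis using p by simp
  qed
  ultimately show ?thesis by blast
qed

text \<open>\<open>spectral_radius\<close> is a \<open>Max\<close>, which bounds its elements only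
  over a finite set. Every eigenvalue is a root of an annihilating polynomial.\<close>

lemma finite_eigenvalues: "finite (eigenvalues M)"
proof -
  obtain p where p: "p \<noteq> 0" "\<And>v. poly_orbit (map_matrix complex_of_real M) p v = 0"
    using ex_annihilating_poly by blast
  have "eigenvalues M \<subseteq> {c. poly p c = 0}"
  proof
    fix c assume "c \<in> eigenvalues M"
    then obtain v where "v \<noteq> 0" "map_matrix complex_of_real M *v v = c *s v"
      by (auto simp: eigenvalues_def)
    then show "c \<in> {c. poly p c = 0}"
      using p(2)[of v] by (simp add: poly_orbit_eigenvector)
  qed
  then show ?thesis using poly_roots_finite[OF p(1)] finite_subset by blast
qed

lemma summable_orbit:
  fixes M :: "real^'n^'n"
  assumes "spectral_radius M < 1"
  shows "summable (\<lambda>t. norm ((((*v) M) ^^ t) x))"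
proof -
  \<comment> \<open>Eigenvalues are complex, so the orbit is followed in the complexification; the
    embedding \<open>cv\<close> preserves norms.\<close>
  define C where "C = map_matrix complex_of_real M"
  define cv where "cv y = (\<chi> i. complex_of_real (y $ i))" for y :: "real^'n"
  have eig: "cmod c < 1" if "v \<noteq> 0" "C *v v = c *s v" for c v
  proof -
    have "c \<in> eigenvalues M" using that by (auto simp: eigenvalues_def C_def)
    then have "cmod c \<le> spectral_radius M"
      unfolding spectral_radius_def by (intro Max_ge) (auto simp: finite_eigenvalues)
    with assms show ?thesis by simp
  qed
  have cv: "C *v cv y = cv (M *v y)" for y
    by (simp add: vec_eq_iff C_def cv_def matrix_vector_mult_def)
  have "(((*v) C) ^^ t) (cv x) = cv ((((*v) M) ^^ t) x)" for t
    by (induction t) (auto simp: cv)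
  moreover have "norm (cv y) = norm y" for y
    by (simp add: cv_def norm_vec_def)
  moreover have "summable (\<lambda>t. norm ((((*v) C) ^^ t) (cv x)))"
    using ex_annihilating_poly[of C] summable_orbit_if_annihilated[of C] eig by blast
  ultimately show ?thesis by simp
qed

section \<open>Lyapunov equations and the cost of a gain\<close>

definition lyap :: "real^'n^'n \<Rightarrow> real^'n^'n \<Rightarrow> real^'n^'n" where
  "lyap F P = transpose F ** P ** F"

text \<open>The Neumann series for the inverse of the operator sending \<open>Z\<close> to
  \<open>Z - lyap F Z\<close>.\<close>

definition lyap_sol :: "real^'n^'n \<Rightarrow> real^'n^'n \<Rightarrow> real^'n^'n" where
  "lyap_sol F P = (\<Sum>t. (lyap F ^^ t) P)"

lemma bounded_bilinear_matrix_mult: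
  "bounded_bilinear ((**) :: real^'n^'m \<Rightarrow> real^'p^'n \<Rightarrow> real^'p^'m)"
  unfolding bilinear_conv_bounded_bilinear[symmetric]
  by (auto simp: bilinear_def vec_eq_iff matrix_matrix_mult_def sum.distrib algebra_simps
      sum_distrib_left intro!: linearI)

lemma bounded_linear_transpose: "bounded_linear (transpose :: real^'n^'m \<Rightarrow> real^'m^'n)"
  unfolding linear_conv_bounded_linear[symmetric]
  by (auto simp: vec_eq_iff transpose_def intro!: linearI)

lemma bounded_linear_lyap: "bounded_linear (lyap F)"
  unfolding lyap_def
  by (rule bounded_linear_compose[OF
        bounded_bilinear.bounded_linear_left[OF bounded_bilinear_matrix_mult]
        bounded_bilinear.bounded_linear_right[OF bounded_bilinear_matrix_mult]])

lemma inner_vector_matrix_mult: "x \<bullet> (w v* (F::real^'n^'m)) = (F *v x) \<bullet> w"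
  by (metis dot_lmul_matrix inner_commute)

text \<open>Powers of the operator are shifted onto orbits of vectors. Two different vectors are
  allowed so that every entry of the power is reached, not only its quadratic form.\<close>

lemma inner_lyap_power:
  "x \<bullet> ((lyap F ^^ t) P *v y) = (((*v) F) ^^ t) x \<bullet> (P *v (((*v) F) ^^ t) y)"
proof (induction t arbitrary: x y)
  case (Suc t)
  have "x \<bullet> ((lyap F ^^ Suc t) P *v y) = (F *v x) \<bullet> ((lyap F ^^ t) P *v (F *v y))"
    by (simp add: lyap_def matrix_vector_mul_assoc[symmetric] inner_vector_matrix_mult)
  also have "\<dots> = (((*v) F) ^^ t) (F *v x) \<bullet> (P *v (((*v) F) ^^ t) (F *v y))"
    by (rule Suc)
  finally show ?case by (simp add: funpow_swap1)
qed auto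

lemma summable_mult_nonneg:
  fixes a b :: "nat \<Rightarrow> real"
  assumes "summable a" "summable b" "\<And>t. 0 \<le> a t" "\<And>t. 0 \<le> b t"
  shows "summable (\<lambda>t. a t * b t)"
proof (rule summable_comparison_test')
  show "summable (\<lambda>t. suminf a * b t)" using assms by (intro summable_mult)
  fix t :: nat
  have "a t \<le> suminf a" using sum_le_suminf[OF assms(1), of "{t}"] assms by simp
  then show "norm (a t * b t) \<le> suminf a * b t"
    using assms by (simp add: abs_mult mult_right_mono)
qed

lemma summable_bilinear_orbit:
  fixes F P :: "real^'n^'n"
  assumes "spectral_radius F < 1"
  shows "summable (\<lambda>t. norm ((((*v) F) ^^ t) x \<bullet> (P *v (((*v) F) ^^ t) y)))"
proof -
  obtain c where c: "\<And>z. norm (P *v z) \<le> norm z * c"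
    using bounded_linear.bounded[OF matrix_vector_mul_bounded_linear] by blast
  have "summable (\<lambda>t. norm ((((*v) F) ^^ t) x) * norm ((((*v) F) ^^ t) y))"
    using assms by (intro summable_mult_nonneg summable_orbit) auto
  then have "summable (\<lambda>t. c * (norm ((((*v) F) ^^ t) x) * norm ((((*v) F) ^^ t) y)))"
    by (rule summable_mult)
  then show ?thesis
  proof (rule summable_comparison_test')
    fix t :: nat
    have "norm ((((*v) F) ^^ t) x \<bullet> (P *v (((*v) F) ^^ t) y))
        \<le> norm ((((*v) F) ^^ t) x) * norm (P *v (((*v) F) ^^ t) y)"
      by (simp add: Cauchy_Schwarz_ineq2)
    also have "\<dots> \<le> norm ((((*v) F) ^^ t) x) * (norm ((((*v) F) ^^ t) y) * c)"
      by (intro mult_left_mono c) auto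
    finally show "norm (norm ((((*v) F) ^^ t) x \<bullet> (P *v (((*v) F) ^^ t) y)))
        \<le> c * (norm ((((*v) F) ^^ t) x) * norm ((((*v) F) ^^ t) y))"
      by (simp add: mult_ac)
  qed
qed

text \<open>The spectrum of the operator \<open>lyap F\<close> is never examined: each entry of a
  power is a bilinear form in two orbits of \<open>F\<close>, and these are summable.\<close>

lemma summable_lyap:
  fixes F P :: "real^'n^'n"
  assumes "spectral_radius F < 1"
  shows "summable (\<lambda>t. norm ((lyap F ^^ t) P))"
proof (rule summable_comparison_test')
  have entry: "Z $ i $ j = axis i 1 \<bullet> (Z *v axis j 1)" for Z :: "real^'n^'n" and i j
    by (simp add: matrix_vector_mult_basis inner_axis' column_def)
  show "summable (\<lambda>t. \<Sum>i\<in>UNIV. \<Sum>j\<in>UNIV. norm ((lyap F ^^ t) P $ i $ j))"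
    unfolding entry inner_lyap_power
    by (intro summable_sum summable_bilinear_orbit assms)
  have l1: "norm Z \<le> (\<Sum>i\<in>UNIV. norm (Z $ i))" for Z :: "real^'n^'n"
    by (simp add: norm_vec_def[of Z] L2_set_le_sum)
  fix t :: nat
  show "norm (norm ((lyap F ^^ t) P))
      \<le> (\<Sum>i\<in>UNIV. \<Sum>j\<in>UNIV. norm ((lyap F ^^ t) P $ i $ j))"
    unfolding real_norm_def abs_norm_cancel
    by (rule order_trans[OF l1]) (auto intro!: sum_mono simp: norm_le_l1_cart)
qed

lemma lyap_sol_eq:
  assumes "spectral_radius F < 1"
  shows "lyap_sol F P - lyap F (lyap_sol F P) = P"
proof -
  note s = summable_norm_cancel[OF summable_lyap[OF assms, of P]]
  have "lyap F (lyap_sol F P) = (\<Sum>t. (lyap F ^^ Suc t) P)"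
    unfolding lyap_sol_def by (simp add: bounded_linear.suminf[OF bounded_linear_lyap s])
  also have "\<dots> = lyap_sol F P - P"
    using suminf_split_head[OF s] by (simp add: lyap_sol_def)
  finally show ?thesis by simp
qed

text \<open>A fixed point equals all its images under powers of \<open>lyap F\<close>, and a
  constant sequence is summable only if it vanishes. This is the injectivity that the implicit
  differentiation requires.\<close>

lemma lyap_fixed_point_zero:
  assumes "spectral_radius F < 1" "Z - lyap F Z = 0"
  shows "Z = 0"
proof -
  have "(lyap F ^^ t) Z = Z" for t
    using assms(2) by (induction t) auto
  with summable_lyap[OF assms(1), of Z] show ?thesis by (simp add: summable_const_iff)
qed

lemma sums_lyap_sol:
  fixes F P :: "real^'n^'n"
  assumes "spectral_radius F < 1"
  shows "(\<lambda>t. (((*v) F) ^^ t) x \<bullet> (P *v (((*v) F) ^^ t) x)) sums (x \<bullet> (lyap_sol F P *v x))"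
proof -
  have "linear (\<lambda>Z. x \<bullet> (Z *v x))"
  proof (rule linearI)
    show "x \<bullet> ((Y + Z) *v x) = x \<bullet> (Y *v x) + x \<bullet> (Z *v x)" for Y Z :: "real^'n^'n"
      by (simp add: matrix_vector_mult_add_rdistrib inner_add_right)
    show "x \<bullet> ((c *\<^sub>R Z) *v x) = c *\<^sub>R (x \<bullet> (Z *v x))" for c and Z :: "real^'n^'n"
      by (simp only: scaleR_matrix_vector_assoc[symmetric] inner_scaleR_right real_scaleR_def)
  qed
  then have "bounded_linear (\<lambda>Z. x \<bullet> (Z *v x))" by (simp only: linear_conv_bounded_linear)
  then have "(\<lambda>t. x \<bullet> ((lyap F ^^ t) P *v x)) sums (x \<bullet> (lyap_sol F P *v x))"
    unfolding lyap_sol_def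
    by (rule bounded_linear.sums)
      (rule summable_sums[OF summable_norm_cancel[OF summable_lyap[OF assms]]])
  then show ?thesis by (simp add: inner_lyap_power)
qed

text \<open>
  With \<open>V\<close> a left inverse of \<open>L x0\<close> and \<open>h x = q x - L x (p x0)\<close>, which vanishes at \<open>x0\<close>, the
  increment of \<open>p\<close> is \<open>V (h x)\<close> up to an error of the order of \<open>norm (L x - L x0) * norm (h x)\<close>.
\<close>

lemma implicit_linear_differentiable:
  fixes L :: "'a::real_normed_vector \<Rightarrow> 'b::euclidean_space \<Rightarrow> 'b"
  assumes lin: "\<And>x. linear (L x)" and inj: "\<And>z. L x0 z = 0 \<Longrightarrow> z = 0"
    and dL: "\<And>z. (\<lambda>x. L x z) differentiable (at x0)" and dq: "q differentiable (at x0)"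
    and ev: "eventually (\<lambda>x. L x (p x) = q x) (at x0)" and eq0: "L x0 (p x0) = q x0"
  shows "p differentiable (at x0)"
proof -
  have "inj (L x0)" using linear_injective_0[OF lin] inj by blast
  then obtain V where V: "linear V" "V \<circ> L x0 = id"
    using linear_injective_left_inverse[OF lin] by blast
  then have VL: "V (L x0 z) = z" for z by (metis comp_apply id_apply)
  have bV: "bounded_linear V" using V(1) by (simp add: linear_conv_bounded_linear)
  obtain C where C: "C > 0" "\<And>z. norm (V z) \<le> norm z * C"
    using bounded_linear.pos_bounded[OF bV] by blast
  define h where "h x = q x - L x (p x0)" for x
  have "h differentiable (at x0)" unfolding h_def by (intro differentiable_diff dq dL)
  then obtain h' where h': "(h has_derivative h') (at x0)" unfolding differentiable_def by blast
  then have bh: "bounded_linear h'" by (rule has_derivative_bounded_linear)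
  obtain H where H: "H > 0" "\<And>z. norm (h' z) \<le> norm z * H"
    using bounded_linear.pos_bounded[OF bh] by blast
  have h0: "h x0 = 0" by (simp add: h_def eq0)
  \<comment> \<open>Only pointwise continuity of \<open>L\<close> is at hand; summing over the basis
    turns it into a bound for the operator norm of \<open>L x - L x0\<close> that tends to
    0.\<close>
  define \<omega> where "\<omega> x = (\<Sum>b\<in>Basis. norm (L x b - L x0 b))" for x
  have \<omega>_bound: "norm (L x z - L x0 z) \<le> \<omega> x * norm z" for x z
  proof -
    have ex: "L x z = (\<Sum>b\<in>Basis. (z \<bullet> b) *\<^sub>R L x b)" for x
      using linear_sum[OF lin[of x], of "\<lambda>b. (z \<bullet> b) *\<^sub>R b" Basis]
      by (simp add: euclidean_representation linear_scale[OF lin])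
    have "norm (L x z - L x0 z) = norm (\<Sum>b\<in>Basis. (z \<bullet> b) *\<^sub>R (L x b - L x0 b))"
      by (simp add: ex[of x] ex[of x0] sum_subtractf scaleR_diff_right)
    also have "\<dots> \<le> (\<Sum>b\<in>Basis. \<bar>z \<bullet> b\<bar> * norm (L x b - L x0 b))"
      by (rule order_trans[OF norm_sum]) simp
    also have "\<dots> \<le> (\<Sum>b\<in>Basis. norm z * norm (L x b - L x0 b))"
      by (intro sum_mono mult_right_mono Basis_le_norm) auto
    finally show ?thesis by (simp add: \<omega>_def sum_distrib_left mult.commute)
  qed
  have "((\<lambda>x. L x b) \<longlongrightarrow> L x0 b) (at x0)" for b
    using differentiable_imp_continuous_within[OF dL] by (simp add: continuous_within)
  then have "(\<omega> \<longlongrightarrow> (\<Sum>b\<in>Basis. norm (L x0 b - L x0 b))) (at x0)"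
    unfolding \<omega>_def by (intro tendsto_intros)
  then have \<omega>0: "(\<omega> \<longlongrightarrow> 0) (at x0)" by simp
  have \<omega>nn: "\<omega> x \<ge> 0" for x by (simp add: \<omega>_def sum_nonneg)
  define e where "e x = norm ((h x - h x0) - h' (x - x0)) / norm (x - x0)" for x
  have e0: "(e \<longlongrightarrow> 0) (at x0)"
    using h' unfolding has_derivative_iff_norm e_def by blast
  have main: "norm ((p x - p x0) - V (h' (x - x0))) / norm (x - x0)
      \<le> C * e x + 2 * C\<^sup>2 * \<omega> x * (e x + H)"
    if eq: "L x (p x) = q x" and small: "\<omega> x < 1 / (2 * C)" and ne: "x \<noteq> x0" for x
  proof -
    define z where "z = p x - p x0"
    define n where "n = norm (x - x0)"
    have n: "n > 0" using ne by (simp add: n_def)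
    have Lz: "L x z = h x" by (simp add: z_def h_def linear_diff[OF lin] eq)
    have zV: "z = V (h x) - V (L x z - L x0 z)"
      by (simp add: linear_diff[OF V(1)] Lz VL)
    have Vd: "norm (V (L x z - L x0 z)) \<le> C * \<omega> x * norm z"
      using C(2)[of "L x z - L x0 z"] \<omega>_bound[of x z] C(1)
      by (smt (verit) mult.assoc mult.commute mult_left_mono)
    have "norm z \<le> norm (V (h x)) + norm (V (L x z - L x0 z))"
      by (subst zV) (rule norm_triangle_ineq4)
    also have "\<dots> \<le> norm (h x) * C + (C * \<omega> x) * norm z"
      using C(2) Vd by (intro add_mono) auto
    \<comment> \<open>Close to \<open>x0\<close> the factor is below 1/2, so the term moves to the
      left-hand side. This is an a priori bound on the increment of \<open>p\<close>, whose
      continuity is not yet known.\<close>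
    also have "(C * \<omega> x) * norm z \<le> (1/2) * norm z"
      using small C(1) by (intro mult_right_mono) (auto simp: field_simps)
    finally have z: "norm z \<le> 2 * C * norm (h x)" by (simp add: mult_ac)
    have hx: "norm (h x - h' (x - x0)) = e x * n"
      using n by (simp add: e_def n_def h0)
    have "norm (h x) \<le> norm (h x - h' (x - x0)) + norm (h' (x - x0))"
      by (metis norm_triangle_ineq diff_add_cancel)
    also have "\<dots> \<le> e x * n + n * H" using hx H(2)[of "x - x0"] by (simp add: n_def)
    finally have hb: "norm (h x) \<le> n * (e x + H)" by (simp add: algebra_simps)
    have "z - V (h' (x - x0)) = V (h x - h' (x - x0)) - V (L x z - L x0 z)"
      by (subst zV) (simp add: linear_diff[OF V(1)])
    then have "norm (z - V (h' (x - x0)))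
        \<le> norm (V (h x - h' (x - x0))) + norm (V (L x z - L x0 z))"
      by (metis norm_triangle_ineq4)
    also have "\<dots> \<le> (e x * n) * C + C * \<omega> x * norm z"
      using C(2)[of "h x - h' (x - x0)"] Vd hx by (intro add_mono) auto
    also have "C * \<omega> x * norm z \<le> C * \<omega> x * (2 * C * (n * (e x + H)))"
      using z hb C(1) \<omega>nn[of x]
      by (intro mult_left_mono order_trans[OF z]) auto
    finally have "norm (z - V (h' (x - x0))) \<le> n * (C * e x + 2 * C\<^sup>2 * \<omega> x * (e x + H))"
      by (simp add: algebra_simps power2_eq_square)
    then show ?thesis using n by (simp add: z_def n_def field_simps)
  qed
  have "(p has_derivative (\<lambda>y. V (h' y))) (at x0)"
    unfolding has_derivative_iff_norm
  proof
    show "bounded_linear (\<lambda>y. V (h' y))" by (rule bounded_linear_compose[OF bV bh])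
    have "eventually (\<lambda>x. \<omega> x < 1 / (2 * C)) (at x0)"
      using order_tendstoD(2)[OF \<omega>0] C(1) by simp
    moreover have "eventually (\<lambda>x. x \<noteq> x0) (at x0)" by (simp add: eventually_at_filter)
    ultimately have e1: "eventually (\<lambda>x. norm ((p x - p x0) - V (h' (x - x0))) / norm (x - x0)
        \<le> C * e x + 2 * C\<^sup>2 * \<omega> x * (e x + H)) (at x0)"
      using ev by eventually_elim (rule main)
    have "((\<lambda>x. C * e x + 2 * C\<^sup>2 * \<omega> x * (e x + H)) \<longlongrightarrow> C * 0 + 2 * C\<^sup>2 * 0 * (0 + H)) (at x0)"
      by (intro tendsto_intros e0 \<omega>0)
    then have e2: "((\<lambda>x. C * e x + 2 * C\<^sup>2 * \<omega> x * (e x + H)) \<longlongrightarrow> 0) (at x0)" by simp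
    show "((\<lambda>x. norm ((p x - p x0) - V (h' (x - x0))) / norm (x - x0)) \<longlongrightarrow> 0) (at x0)"
      by (rule tendsto_sandwich[OF always_eventually e1 tendsto_const e2]) simp
  qed
  then show ?thesis unfolding differentiable_def by blast
qed

lemma differentiable_matrix_mult:
  fixes f :: "'a::real_normed_vector \<Rightarrow> real^'n^'m" and g :: "'a \<Rightarrow> real^'p^'n"
  assumes "f differentiable (at x)" "g differentiable (at x)"
  shows "(\<lambda>y. f y ** g y) differentiable (at x)"
  using assms bounded_bilinear.FDERIV[OF bounded_bilinear_matrix_mult]
  unfolding differentiable_def by blast

lemma differentiable_transpose:
  fixes f :: "'a::real_normed_vector \<Rightarrow> real^'n^'m"
  assumes "f differentiable (at x)"
  shows "(\<lambda>y. transpose (f y)) differentiable (at x)"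
  using assms bounded_linear.has_derivative[OF bounded_linear_transpose]
  unfolding differentiable_def by blast

section \<open>The LQR cost: closed form, differentiability and gradient\<close>

definition cost_matrix ::
  "real^'n^'n \<Rightarrow> real^'m^'n \<Rightarrow> real^'n^'n \<Rightarrow> real^'m^'m \<Rightarrow> real^'n^'m \<Rightarrow> real^'n^'n" where
  "cost_matrix A B Q R K = lyap_sol (A - B ** K) (Q + transpose K ** R ** K)"

lemma cost_matrix_differentiable:
  fixes A :: "real^'n^'n" and B :: "real^'m^'n" and K :: "real^'n^'m"
  assumes "open (stabilizing A B)" "K \<in> stabilizing A B"
  shows "cost_matrix A B Q R differentiable (at K)"
proof -
  define L where "L K Z = Z - lyap (A - B ** K) Z" for K :: "real^'n^'m" and Z
  define q where "q K = Q + transpose K ** R ** K" for K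
  have lin: "linear (L K)" for K
    unfolding L_def
    by (rule bounded_linear.linear[OF bounded_linear_sub[OF bounded_linear_ident bounded_linear_lyap]])
  have inj: "Z = 0" if "L K Z = 0" for Z
    by (rule lyap_fixed_point_zero[of "A - B ** K"])
      (use that assms(2) in \<open>auto simp: stabilizing_def L_def\<close>)
  have dL: "(\<lambda>K. L K Z) differentiable at K" for Z
    unfolding L_def lyap_def
    by (rule differentiable_diff differentiable_const differentiable_matrix_mult
        differentiable_transpose differentiable_ident)+
  have dq: "q differentiable at K"
    unfolding q_def
    by (rule differentiable_add differentiable_const differentiable_matrix_mult
        differentiable_transpose differentiable_ident)+
  have eq: "L K (cost_matrix A B Q R K) = q K" if "K \<in> stabilizing A B" for K
    using that by (simp add: cost_matrix_def stabilizing_def lyap_sol_eq L_def q_def)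
  have "\<forall>\<^sub>F K in at K. L K (cost_matrix A B Q R K) = q K"
    using eventually_at_in_open'[OF assms] by eventually_elim (rule eq)
  then show ?thesis
    using implicit_linear_differentiable[of L K q "cost_matrix A B Q R", OF lin inj dL dq _ eq[OF assms(2)]] by blast
qed

lemma lqr_state_eq: "lqr_state A B K x t = (((*v) (A - B ** K)) ^^ t) x"
proof (induction t)
  case (Suc t)
  have "A *v y + B *v (- (K *v y)) = (A - B ** K) *v y" for y
    by (simp add: matrix_vector_mult_diff_rdistrib matrix_vector_mul_assoc[symmetric] vec.neg)
  with Suc show ?case by simp
qed simp

lemma stage_cost_feedback:
  "stage_cost Q R x (- (K *v x)) = x \<bullet> ((Q + transpose K ** R ** K) *v x)"
  by (simp add: stage_cost_def matrix_vector_mult_add_rdistrib inner_add_right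
      matrix_vector_mul_assoc[symmetric] inner_vector_matrix_mult vec.neg)

lemma traj_cost_eq:
  assumes "K \<in> stabilizing A B"
  shows "traj_cost A B Q R K x = ereal (x \<bullet> (cost_matrix A B Q R K *v x))"
proof -
  have "(\<lambda>t. ereal (stage_cost Q R (lqr_state A B K x t) (- (K *v lqr_state A B K x t))))
      sums ereal (x \<bullet> (cost_matrix A B Q R K *v x))"
    unfolding sums_ereal stage_cost_feedback lqr_state_eq cost_matrix_def
    using assms by (intro sums_lyap_sol) (simp add: stabilizing_def)
  then show ?thesis using assms by (simp add: traj_cost_def sums_unique[symmetric])
qed

text \<open>The almost sure bound makes products of coordinates integrable; their means form the
  identity matrix, so the double sum collapses to the diagonal of \<open>P\<close>.\<close>

lemma
  fixes \<D> :: "(real^'n) measure"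
  assumes "initial_law \<D> Cm"
  shows integrable_quadratic_form: "integrable \<D> (\<lambda>x. x \<bullet> (P *v x))"
    and integral_quadratic_form: "(\<integral>x. x \<bullet> (P *v x) \<partial>\<D>) = trace P"
proof -
  interpret prob_space \<D> using assms by (simp add: initial_law_def)
  have sets [measurable_cong]: "sets \<D> = sets borel" using assms by (simp add: initial_law_def)
  have ij: "integrable \<D> (\<lambda>x. x $ i * x $ j)" for i j
  proof (rule integrable_const_bound)
    have "AE x in \<D>. (norm x)\<^sup>2 \<le> Cm" using assms by (simp add: initial_law_def)
    then show "AE x in \<D>. norm (x $ i * x $ j) \<le> Cm"
    proof eventually_elim
      case (elim x)
      have "norm (x $ i * x $ j) \<le> norm x * norm x"
        unfolding norm_mult by (intro mult_mono) (auto simp: component_le_norm_cart)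
      with elim show ?case by (simp add: power2_eq_square)
    qed
    have "(\<lambda>x::real^'n. x $ i * x $ j) \<in> borel_measurable borel"
      by (intro borel_measurable_continuous_onI continuous_on_mult continuous_on_component continuous_on_id)
    then show "(\<lambda>x. x $ i * x $ j) \<in> borel_measurable \<D>"
      using sets by (simp cong: measurable_cong_sets)
  qed
  have eq: "x \<bullet> (P *v x) = (\<Sum>i\<in>UNIV. \<Sum>j\<in>UNIV. P $ i $ j * (x $ i * x $ j))" for x
    by (simp add: inner_vec_def matrix_vector_mult_def sum_distrib_left mult_ac)
  show "integrable \<D> (\<lambda>x. x \<bullet> (P *v x))"
    unfolding eq by (intro Bochner_Integration.integrable_sum integrable_mult_right ij)
  have "(\<integral>x. x \<bullet> (P *v x) \<partial>\<D>)
      = (\<Sum>i\<in>UNIV. \<Sum>j\<in>UNIV. P $ i $ j * (\<integral>x. x $ i * x $ j \<partial>\<D>))"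
    unfolding eq by (simp add: Bochner_Integration.integral_sum Bochner_Integration.integrable_sum
        integrable_mult_right ij)
  also have "\<dots> = (\<Sum>i\<in>UNIV. \<Sum>j\<in>UNIV. if j = i then P $ i $ j else 0)"
    using assms by (intro sum.cong refl) (auto simp: initial_law_def mat_def)
  finally show "(\<integral>x. x \<bullet> (P *v x) \<partial>\<D>) = trace P" by (simp add: trace_def)
qed

lemma lqr_cost_eq:
  assumes "initial_law \<D> Cm" "K \<in> stabilizing A B"
  shows "lqr_cost A B Q R \<D> K = ereal (trace (cost_matrix A B Q R K))"
  using assms(2) integral_quadratic_form[OF assms(1)]
  by (simp add: lqr_cost_def traj_cost_eq)

text \<open>\<open>gradient\<close> is defined by \<open>THE\<close>, so the derivative must be
  shown to exist and its representing vector to be unique. The vector is assembled from the values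
  of the derivative on the basis.\<close>

lemma lqr_cost_GDERIV:
  fixes A :: "real^'n^'n" and B :: "real^'m^'n"
  assumes "initial_law \<D> Cm" "open (stabilizing A B)" "K \<in> stabilizing A B"
  shows "GDERIV (\<lambda>K. real_of_ereal (lqr_cost A B Q R \<D> K)) K :> gradient (lqr_cost A B Q R \<D>) K"
proof -
  let ?j = "\<lambda>K. real_of_ereal (lqr_cost A B Q R \<D> K)"
  obtain P' where P': "(cost_matrix A B Q R has_derivative P') (at K)"
    using cost_matrix_differentiable[OF assms(2,3)] unfolding differentiable_def by blast
  have "bounded_linear (trace :: real^'n^'n \<Rightarrow> real)"
    unfolding linear_conv_bounded_linear[symmetric]
    by (auto simp: trace_def sum.distrib sum_distrib_left intro!: linearI)
  from bounded_linear.has_derivative[OF this P']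
  have "((\<lambda>K. trace (cost_matrix A B Q R K)) has_derivative (\<lambda>x. trace (P' x))) (at K)" .
  then have d: "(?j has_derivative (\<lambda>x. trace (P' x))) (at K)"
    by (rule has_derivative_transform_within_open[OF _ assms(2,3)])
      (simp add: lqr_cost_eq[OF assms(1)])
  then have lin: "linear (\<lambda>x. trace (P' x))" by (rule has_derivative_linear)
  define g where "g = (\<Sum>b\<in>Basis. trace (P' b) *\<^sub>R b)"
  have "trace (P' x) = x \<bullet> g" for x
  proof -
    have "trace (P' x) = trace (P' (\<Sum>b\<in>Basis. (x \<bullet> b) *\<^sub>R b))"
      by (simp add: euclidean_representation)
    also have "\<dots> = (\<Sum>b\<in>Basis. (x \<bullet> b) * trace (P' b))"
      using linear_sum[OF lin, of "\<lambda>b. (x \<bullet> b) *\<^sub>R b" Basis] linear_scale[OF lin] by simp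
    finally show ?thesis by (simp add: g_def inner_sum_right mult.commute)
  qed
  then have g: "GDERIV ?j K :> g" using d by (simp add: gderiv_def)
  moreover have "g' = g" if "GDERIV ?j K :> g'" for g'
  proof -
    have "(\<lambda>h. h \<bullet> g') = (\<lambda>h. h \<bullet> g)"
      using that g unfolding gderiv_def by (rule has_derivative_unique)
    then have "(g' - g) \<bullet> (g' - g) = 0" by (metis inner_diff_right right_minus_eq)
    then show ?thesis by simp
  qed
  ultimately have "gradient (lqr_cost A B Q R \<D>) K = g"
    unfolding gradient_def by (rule the_equality)
  with g show ?thesis by simp
qed

section \<open>The uniform distribution on the sphere\<close>

lemma ball_lborel_nontrivial:
  "emeasure lborel (ball (0::'a::euclidean_space) 1) \<noteq> 0"
  "emeasure lborel (ball (0::'a::euclidean_space) 1) \<noteq> \<infinity>"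
  by (simp_all add: emeasure_ball less_imp_neq[THEN not_sym])

text \<open>
  Uniqueness of the Haar measure specialised to isometries: integrate
  \<open>indicator S (f x + y) * indicator (ball 0 1) y\<close> over \<open>x\<close> and \<open>y\<close> in both orders.
\<close>

lemma lborel_distr_isometry:
  fixes f :: "'a::euclidean_space \<Rightarrow> 'a"
  assumes lin: "linear f" and iso: "\<And>x. norm (f x) = norm x"
  shows "distr lborel borel f = lborel"
proof (rule measure_eqI)
  have fm [measurable]: "f \<in> borel_measurable borel"
    using lin by (intro borel_measurable_continuous_onI linear_continuous_on)
      (simp add: linear_conv_bounded_linear)
  have "inj f" unfolding linear_injective_0[OF lin] by (metis iso norm_eq_zero)
  then have surj: "surj f" using lin linear_injective_imp_surjective by blast
  have shift: "(\<integral>\<^sup>+y. h (c + y) \<partial>lborel) = (\<integral>\<^sup>+y. h y \<partial>lborel)"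
    if [measurable]: "h \<in> borel_measurable borel" for h and c :: 'a
    by (subst (2) lborel_distr_plus[symmetric, of c], subst nn_integral_distr) auto
  let ?B = "ball 0 1 :: 'a set"
  have [measurable]: "?B \<in> sets borel" by simp
  fix S assume "S \<in> sets (distr lborel borel f)"
  then have S[measurable]: "S \<in> sets borel" by simp
  define I where "I = (\<integral>\<^sup>+y. \<integral>\<^sup>+x. indicator S (f x + y) * indicator ?B y \<partial>lborel \<partial>lborel)"
  have "(\<integral>\<^sup>+x. indicator S (f x + y) \<partial>lborel) = emeasure (distr lborel borel f) S" for y
  proof -
    \<comment> \<open>Surjectivity turns the translation by \<open>y\<close> into a translation
      inside the argument of \<open>f\<close>, where \<open>lborel\<close> is invariant.\<close>
    obtain c where c: "y = f c" using surj by (metis surjD)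
    have "(\<integral>\<^sup>+x. indicator S (f x + y) \<partial>lborel) = (\<integral>\<^sup>+x. indicator S (f (c + x)) \<partial>lborel)"
      by (simp add: c linear_add[OF lin] add.commute)
    also have "\<dots> = (\<integral>\<^sup>+x. indicator S (f x) \<partial>lborel)" by (rule shift) measurable
    also have "\<dots> = (\<integral>\<^sup>+x. indicator (f -` S) x \<partial>lborel)" by (simp add: indicator_def)
    also have "\<dots> = emeasure (distr lborel borel f) S"
      by (subst nn_integral_indicator) (auto simp: emeasure_distr measurable_sets_borel[OF fm])
    finally show ?thesis .
  qed
  then have 1: "I = emeasure (distr lborel borel f) S * emeasure lborel ?B"
    unfolding I_def by (subst nn_integral_multc) (auto simp: nn_integral_cmult_indicator)
  have "I = (\<integral>\<^sup>+x. \<integral>\<^sup>+y. indicator S (f x + y) * indicator ?B y \<partial>lborel \<partial>lborel)"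
    unfolding I_def by (rule lborel_pair.Fubini') measurable
  also have "\<dots> = (\<integral>\<^sup>+x. \<integral>\<^sup>+y. indicator S y * indicator ?B (y - f x) \<partial>lborel \<partial>lborel)"
  proof (rule nn_integral_cong)
    fix x
    show "(\<integral>\<^sup>+y. indicator S (f x + y) * indicator ?B y \<partial>lborel)
        = (\<integral>\<^sup>+y. indicator S y * indicator ?B (y - f x) \<partial>lborel)"
      using shift[of "\<lambda>y. indicator S y * indicator ?B (y - f x)" "f x"] by simp
  qed
  also have "\<dots> = (\<integral>\<^sup>+y. \<integral>\<^sup>+x. indicator S y * indicator ?B (y - f x) \<partial>lborel \<partial>lborel)"
    by (rule lborel_pair.Fubini') measurable
  also have "\<dots> = (\<integral>\<^sup>+y. indicator S y * emeasure lborel ?B \<partial>lborel)"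
  proof (rule nn_integral_cong)
    fix y
    \<comment> \<open>As \<open>f\<close> is an isometry, \<open>y - f x\<close> lies in the ball
      exactly if \<open>c - x\<close> does; the inner integral is then the volume of the ball,
      whatever \<open>y\<close> is.\<close>
    obtain c where c: "y = f c" using surj by (metis surjD)
    have "(\<integral>\<^sup>+x. indicator ?B (y - f x) \<partial>lborel) = (\<integral>\<^sup>+x. indicator ?B (c - x) \<partial>lborel :: ennreal)"
      by (simp add: c linear_diff[OF lin, symmetric] iso indicator_def)
    also have "\<dots> = (\<integral>\<^sup>+x. indicator ?B (c - (c + x)) \<partial>lborel)"
      by (rule shift[symmetric]) measurable
    also have "\<dots> = (\<integral>\<^sup>+x. indicator ?B x \<partial>lborel)" by (simp add: indicator_def)
    finally show "(\<integral>\<^sup>+x. indicator S y * indicator ?B (y - f x) \<partial>lborel)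
        = (indicator S y * emeasure lborel ?B :: ennreal)"
      by (subst nn_integral_cmult) auto
  qed
  also have "\<dots> = emeasure lborel S * emeasure lborel ?B"
    by (subst nn_integral_multc) auto
  finally have 2: "I = emeasure lborel S * emeasure lborel ?B" .
  show "emeasure (distr lborel borel f) S = emeasure lborel S"
    using 1 2 ball_lborel_nontrivial[where 'a = 'a]
    by (metis infinity_ennreal_def mult_divide_eq_ennreal)
qed simp

lemma sets_unif_sphere [simp, measurable_cong]: "sets unif_sphere = sets borel"
  by (simp add: unif_sphere_def)

lemma space_unif_sphere [simp]: "space unif_sphere = UNIV"
  by (simp add: unif_sphere_def)

lemma borel_measurable_sgn [measurable]:
  "(sgn :: 'a::euclidean_space \<Rightarrow> 'a) \<in> borel_measurable borel"
  unfolding sgn_div_norm[abs_def] by measurable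

lemma prob_space_unif_sphere: "prob_space (unif_sphere :: 'a::euclidean_space measure)"
  unfolding unif_sphere_def
  by (intro prob_space.prob_space_distr prob_space_uniform_measure ball_lborel_nontrivial) measurable

text \<open>A linear isometry preserves the uniform law on the ball and commutes with
  \<open>sgn\<close>, through which the law on the sphere is defined.\<close>

lemma unif_sphere_distr_isometry:
  fixes f :: "'a::euclidean_space \<Rightarrow> 'a"
  assumes lin: "linear f" and iso: "\<And>x. norm (f x) = norm x"
  shows "distr unif_sphere borel f = unif_sphere"
proof -
  have fm[measurable]: "f \<in> borel_measurable borel"
    using lin by (intro borel_measurable_continuous_onI linear_continuous_on)
      (simp add: linear_conv_bounded_linear)
  let ?B = "ball 0 1 :: 'a set"
  let ?U = "uniform_measure lborel ?B"
  have "distr ?U borel f = ?U"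
  proof (rule measure_eqI)
    fix S assume "S \<in> sets (distr ?U borel f)"
    then have S[measurable]: "S \<in> sets borel" by simp
    have "emeasure lborel (?B \<inter> f -` S) = emeasure lborel (f -` (?B \<inter> S))"
      using iso by (intro arg_cong[where f = "emeasure lborel"]) auto
    also have "\<dots> = emeasure (distr lborel borel f) (?B \<inter> S)"
      by (subst emeasure_distr) auto
    also have "\<dots> = emeasure lborel (?B \<inter> S)"
      by (simp add: lborel_distr_isometry[OF assms])
    finally show "emeasure (distr ?U borel f) S = emeasure ?U S"
      by (simp add: emeasure_distr measurable_sets_borel[OF fm])
  qed simp
  moreover have "f (sgn x) = sgn (f x)" for x
    by (simp add: sgn_div_norm linear_scale[OF lin] iso)
  then have "f \<circ> sgn = sgn \<circ> f" by auto
  moreover have "distr ?U borel (sgn \<circ> f) = distr (distr ?U borel f) borel sgn"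
    by (rule distr_distr[symmetric]) measurable
  moreover have "distr (distr ?U borel sgn) borel f = distr ?U borel (f \<circ> sgn)"
    by (rule distr_distr) measurable
  ultimately show ?thesis by (simp add: unif_sphere_def)
qed

text \<open>The centre of the ball is the only point that \<open>sgn\<close> does not send to the
  sphere, and it is a null set.\<close>

lemma AE_unif_sphere_norm: "AE D in unif_sphere. norm (D::'a::euclidean_space) = 1"
proof -
  have "AE x in lborel. x \<noteq> (0::'a)" by (rule AE_lborel_singleton)
  then have "AE x in uniform_measure lborel (ball (0::'a) 1). x \<noteq> 0"
    by (intro AE_uniform_measureI) auto
  then have "AE x in uniform_measure lborel (ball (0::'a) 1). norm (sgn x) = 1"
    by eventually_elim (simp add: norm_sgn)
  then show ?thesis unfolding unif_sphere_def by (subst AE_distr_iff) auto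
qed

text \<open>The reflection across the hyperplane orthogonal to \<open>w\<close>, for
  \<open>w\<close> of any length. At \<open>w = 0\<close> division by zero makes it the identity, so
  linearity and isometry hold without a side condition.\<close>

definition reflect :: "'a::euclidean_space \<Rightarrow> 'a \<Rightarrow> 'a" where
  "reflect w x = x - (2 * (x \<bullet> w) / (w \<bullet> w)) *\<^sub>R w"

lemma linear_reflect: "linear (reflect w)"
  unfolding reflect_def
  by (rule linearI) (simp_all add: inner_add_left algebra_simps add_divide_distrib)

lemma inner_reflect: "reflect w x \<bullet> reflect w y = x \<bullet> y"
  by (cases "w = 0") (simp_all add: reflect_def inner_diff_left inner_diff_right inner_commute)

lemma norm_reflect: "norm (reflect w x) = norm x"
  by (simp add: norm_eq_sqrt_inner inner_reflect)

text \<open>The hyperplane midway between two vectors of equal norm is orthogonal to their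
  difference. Reflections thus carry any unit vector to any other, which is the symmetry used for
  the second moments.\<close>

lemma reflect_diff:
  assumes "norm u = norm v"
  shows "reflect (u - v) u = v"
proof (cases "u = v")
  case False
  have "u \<bullet> u = v \<bullet> v" using assms by (simp add: norm_eq)
  then have "(u - v) \<bullet> (u - v) = 2 * (u \<bullet> (u - v))"
    by (simp add: inner_diff_left inner_diff_right inner_commute)
  moreover have "(u - v) \<bullet> (u - v) \<noteq> 0" using False by simp
  ultimately have "2 * (u \<bullet> (u - v)) / ((u - v) \<bullet> (u - v)) = 1"
    by (metis divide_self)
  then have "reflect (u - v) u = u - 1 *\<^sub>R (u - v)" by (simp only: reflect_def)
  then show ?thesis by simp
qed (simp add: reflect_def)

lemma
  fixes h :: "'a::euclidean_space \<Rightarrow> 'b::{banach, second_countable_topology}" and f :: "'a \<Rightarrow> 'a"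
  assumes lin: "linear f" and iso: "\<And>x. norm (f x) = norm x"
    and h: "h \<in> borel_measurable borel"
  shows integral_unif_sphere_isometry:
      "(\<integral>D. h (f D) \<partial>unif_sphere) = (\<integral>D. h D \<partial>unif_sphere)"
    and integrable_unif_sphere_isometry:
      "integrable unif_sphere h \<Longrightarrow> integrable unif_sphere (\<lambda>D. h (f D))"
proof -
  have [measurable]: "f \<in> borel_measurable borel"
    using lin by (intro borel_measurable_continuous_onI linear_continuous_on)
      (simp add: linear_conv_bounded_linear)
  note h[measurable]
  have "(\<integral>D. h D \<partial>distr unif_sphere borel f) = (\<integral>D. h (f D) \<partial>unif_sphere)"
    by (rule integral_distr) measurable
  then show "(\<integral>D. h (f D) \<partial>unif_sphere) = (\<integral>D. h D \<partial>unif_sphere)"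
    by (simp add: unif_sphere_distr_isometry[OF lin iso])
  assume "integrable unif_sphere h"
  then have "integrable (distr unif_sphere borel f) h"
    by (simp add: unif_sphere_distr_isometry[OF lin iso])
  then show "integrable unif_sphere (\<lambda>D. h (f D))"
    by (rule integrable_distr[rotated]) measurable
qed

lemma integrable_unif_sphere_bounded:
  fixes h :: "'a::euclidean_space \<Rightarrow> 'b::{banach, second_countable_topology}"
  assumes "h \<in> borel_measurable borel" "\<And>D. norm D = 1 \<Longrightarrow> norm (h D) \<le> c"
  shows "integrable unif_sphere h"
proof -
  interpret prob_space "unif_sphere :: 'a measure" by (rule prob_space_unif_sphere)
  show ?thesis
  proof (rule integrable_const_bound)
    show "AE D in unif_sphere. norm (h D) \<le> c"
      using AE_unif_sphere_norm by eventually_elim (rule assms(2))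
    show "h \<in> borel_measurable unif_sphere" using assms(1) by measurable
  qed
qed

text \<open>By symmetry the second moment is the same in every unit direction, and over an
  orthonormal basis these moments add up to the mean of the squared norm of \<open>D\<close>, which
  is 1.\<close>

lemma
  fixes u :: "'a::euclidean_space"
  assumes u: "norm u = 1"
  shows integrable_unif_sphere_sq: "integrable unif_sphere (\<lambda>D. (D \<bullet> u)\<^sup>2)"
    and integral_unif_sphere_sq: "(\<integral>D. (D \<bullet> u)\<^sup>2 \<partial>unif_sphere) = 1 / DIM('a)"
proof -
  interpret prob_space "unif_sphere :: 'a measure" by (rule prob_space_unif_sphere)
  have int: "integrable unif_sphere (\<lambda>D. (D \<bullet> v)\<^sup>2)" if "norm v = 1" for v :: 'a
  proof (rule integrable_unif_sphere_bounded)
    fix D :: 'a assume "norm D = 1"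
    then have "\<bar>D \<bullet> v\<bar> \<le> 1" using Cauchy_Schwarz_ineq2[of D v] that by simp
    then show "norm ((D \<bullet> v)\<^sup>2) \<le> 1" by (simp add: abs_square_le_1)
  qed measurable
  then show "integrable unif_sphere (\<lambda>D. (D \<bullet> u)\<^sup>2)" using u by blast
  have "(\<integral>D. (D \<bullet> b)\<^sup>2 \<partial>unif_sphere) = (\<integral>D. (D \<bullet> u)\<^sup>2 \<partial>unif_sphere)" if b: "b \<in> Basis" for b :: 'a
  proof -
    have "reflect (b - u) b = u" using b u by (intro reflect_diff) simp
    then have "D \<bullet> b = reflect (b - u) D \<bullet> u" for D by (metis inner_reflect)
    then have "(\<integral>D. (D \<bullet> b)\<^sup>2 \<partial>unif_sphere) = (\<integral>D. (reflect (b - u) D \<bullet> u)\<^sup>2 \<partial>unif_sphere)"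
      by simp
    also have "\<dots> = (\<integral>D. (D \<bullet> u)\<^sup>2 \<partial>unif_sphere)"
      by (rule integral_unif_sphere_isometry[OF linear_reflect norm_reflect]) measurable
    finally show ?thesis .
  qed
  then have "DIM('a) * (\<integral>D. (D \<bullet> u)\<^sup>2 \<partial>unif_sphere)
      = (\<Sum>b\<in>Basis. \<integral>D. (D \<bullet> b)\<^sup>2 \<partial>(unif_sphere :: 'a measure))" by simp
  also have "\<dots> = (\<integral>D. (\<Sum>b\<in>Basis. (D \<bullet> b)\<^sup>2) \<partial>(unif_sphere :: 'a measure))"
    by (rule Bochner_Integration.integral_sum[symmetric]) (simp add: int)
  also have "\<dots> = (\<integral>D. 1 \<partial>(unif_sphere :: 'a measure))"
  proof (rule integral_cong_AE)
    show "AE D in unif_sphere. (\<Sum>b\<in>Basis. (D \<bullet> b)\<^sup>2) = (1::real)"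
      using AE_unif_sphere_norm
    proof eventually_elim
      case (elim D)
      then have "D \<bullet> D = 1" by (simp add: norm_eq_1)
      then show ?case by (subst (asm) euclidean_inner) (simp add: power2_eq_square)
    qed
  qed measurable
  finally show "(\<integral>D. (D \<bullet> u)\<^sup>2 \<partial>unif_sphere) = 1 / DIM('a)"
    by (simp add: prob_space[simplified] field_simps)
qed

text \<open>
  Replacing the divergence theorem: testing against a unit vector \<open>u\<close>, the reflection across the
  hyperplane orthogonal to \<open>u\<close> turns \<open>f (K + r D)\<close> into half a difference along \<open>u\<close>, of length
  \<open>2 r \<bar>D \<bullet> u\<bar>\<close>, so that the dimension cancels against the second moment \<open>1 / DIM('a)\<close>.
\<close>

locale sphere_estimate =
  fixes f :: "'a::euclidean_space \<Rightarrow> real" and K g :: 'a and r L :: real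
  assumes f_measurable [measurable]: "f \<in> borel_measurable borel" and r: "r > 0"
    and near_linear: "\<And>x y. x \<in> cball K r \<Longrightarrow> y \<in> cball K r \<Longrightarrow>
      \<bar>f x - f y - g \<bullet> (x - y)\<bar> \<le> L * norm (x - y)"
begin

lemma L_nonneg: "L \<ge> 0"
proof -
  obtain b :: 'a where b: "b \<in> Basis" using nonempty_Basis by blast
  have "0 \<le> L * norm (r *\<^sub>R b)"
    using order_trans[OF abs_ge_zero near_linear[of "K + r *\<^sub>R b" K]] b r
    by (simp add: dist_norm)
  then show ?thesis using b r by (simp add: zero_le_mult_iff)
qed

lemma bounded_on_sphere:
  assumes "norm D = 1"
  shows "\<bar>f (K + r *\<^sub>R D)\<bar> \<le> \<bar>f K\<bar> + norm g * r + L * r"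
proof -
  have "\<bar>f (K + r *\<^sub>R D) - f K - g \<bullet> (r *\<^sub>R D)\<bar> \<le> L * r"
    using near_linear[of "K + r *\<^sub>R D" K] assms r by (simp add: dist_norm)
  moreover have "\<bar>g \<bullet> (r *\<^sub>R D)\<bar> \<le> norm g * r"
    using Cauchy_Schwarz_ineq2[of g "r *\<^sub>R D"] assms r by simp
  ultimately show ?thesis by linarith
qed

lemma integrable_estimate: "integrable unif_sphere (\<lambda>D. f (K + r *\<^sub>R D) *\<^sub>R D)"
  using bounded_on_sphere by (intro integrable_unif_sphere_bounded) auto

lemma directional_bias:
  assumes u: "norm u = 1"
  shows "\<bar>(\<integral>D. f (K + r *\<^sub>R D) * (D \<bullet> u) \<partial>unif_sphere) - r * (g \<bullet> u) / DIM('a)\<bar> \<le> r * L / DIM('a)"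
proof -
  interpret prob_space "unif_sphere :: 'a measure" by (rule prob_space_unif_sphere)
  define h where "h D = f (K + r *\<^sub>R D) * (D \<bullet> u)" for D
  have [measurable]: "h \<in> borel_measurable borel" unfolding h_def by measurable
  have h: "integrable unif_sphere h"
    using integrable_inner_left[OF integrable_estimate] by (simp add: h_def[abs_def])
  let ?s = "reflect u"
  have s: "?s D = D - (2 * (D \<bullet> u)) *\<^sub>R u" for D
    using u by (simp add: reflect_def norm_eq_1)
  have hs: "integrable unif_sphere (\<lambda>D. h (?s D))"
    by (rule integrable_unif_sphere_isometry[OF linear_reflect norm_reflect _ h]) measurable
  \<comment> \<open>\<open>h\<close> and its reflection have the same integral, so \<open>k\<close>
    integrates to twice the deviation in the claim, and a pointwise bound on \<open>k\<close>
    suffices.\<close>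
  define k where "k D = h D + h (?s D) - 2 * r * (g \<bullet> u) * (D \<bullet> u)\<^sup>2" for D
  have sq: "integrable unif_sphere (\<lambda>D. 2 * r * (g \<bullet> u) * (D \<bullet> u)\<^sup>2)"
    by (intro integrable_mult_right integrable_unif_sphere_sq u)
  have k: "integrable unif_sphere k"
    unfolding k_def by (intro Bochner_Integration.integrable_diff Bochner_Integration.integrable_add h hs sq)
  have "(\<integral>D. h (?s D) \<partial>unif_sphere) = (\<integral>D. h D \<partial>unif_sphere)"
    by (rule integral_unif_sphere_isometry[OF linear_reflect norm_reflect]) measurable
  then have eq: "(\<integral>D. k D \<partial>unif_sphere) = 2 * ((\<integral>D. h D \<partial>unif_sphere) - r * (g \<bullet> u) / DIM('a))"
    unfolding k_def
    by (simp add: Bochner_Integration.integral_diff[OF Bochner_Integration.integrable_add[OF h hs] sq]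
        Bochner_Integration.integral_add[OF h hs] u integral_unif_sphere_sq)
  have "\<bar>\<integral>D. k D \<partial>unif_sphere\<bar> \<le> (\<integral>D. \<bar>k D\<bar> \<partial>unif_sphere)"
    by (rule integral_abs_bound)
  also have "\<dots> \<le> (\<integral>D. 2 * r * L * (D \<bullet> u)\<^sup>2 \<partial>unif_sphere)"
  proof (rule integral_mono_AE)
    show "AE D in unif_sphere. \<bar>k D\<bar> \<le> 2 * r * L * (D \<bullet> u)\<^sup>2"
      using AE_unif_sphere_norm
    proof eventually_elim
      case (elim D)
      \<comment> \<open>The reflection changes the sign of \<open>D \<bullet> u\<close>, so
        \<open>h D + h (?s D)\<close> is a difference of two values of \<open>f\<close>, times
        \<open>D \<bullet> u\<close>.\<close>
      have kD: "k D = (f (K + r *\<^sub>R D) - f (K + r *\<^sub>R ?s D)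
            - g \<bullet> ((K + r *\<^sub>R D) - (K + r *\<^sub>R ?s D))) * (D \<bullet> u)"
        using u by (simp add: k_def h_def s algebra_simps inner_diff_left norm_eq_1
            inner_commute power2_eq_square)
      have "norm (?s D) = 1" using elim by (simp add: norm_reflect)
      then have "\<bar>f (K + r *\<^sub>R D) - f (K + r *\<^sub>R ?s D) - g \<bullet> ((K + r *\<^sub>R D) - (K + r *\<^sub>R ?s D))\<bar>
          \<le> L * norm ((K + r *\<^sub>R D) - (K + r *\<^sub>R ?s D))"
        using elim r by (intro near_linear) (auto simp: dist_norm)
      also have "(K + r *\<^sub>R D) - (K + r *\<^sub>R ?s D) = (2 * r * (D \<bullet> u)) *\<^sub>R u"
        by (simp add: s algebra_simps)
      also have "norm \<dots> = 2 * r * \<bar>D \<bullet> u\<bar>" using u r by (simp add: abs_mult)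
      finally have "\<bar>k D\<bar> \<le> L * (2 * r * \<bar>D \<bullet> u\<bar>) * \<bar>D \<bullet> u\<bar>"
        unfolding kD abs_mult by (intro mult_right_mono) (auto simp: s algebra_simps)
      also have "\<dots> = 2 * r * L * (D \<bullet> u)\<^sup>2" by (simp add: power2_eq_square flip: abs_mult)
      finally show ?case .
    qed
  qed (use k in \<open>auto intro!: integrable_mult_right integrable_unif_sphere_sq u\<close>)
  also have "\<dots> = 2 * r * L / DIM('a)" by (simp add: integral_unif_sphere_sq u)
  finally show ?thesis unfolding eq h_def[symmetric] by (simp add: abs_mult)
qed

lemma one_point_bias:
  "norm ((\<integral>D. (f (K + r *\<^sub>R D) * (DIM('a) / r)) *\<^sub>R D \<partial>unif_sphere) - g) \<le> L"
proof -
  let ?I = "\<integral>D. f (K + r *\<^sub>R D) *\<^sub>R D \<partial>unif_sphere"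
  have eq: "(\<integral>D. (f (K + r *\<^sub>R D) * (DIM('a) / r)) *\<^sub>R D \<partial>unif_sphere) = (DIM('a) / r) *\<^sub>R ?I"
    by (simp add: integral_scaleR_right[symmetric] mult.commute del: integral_scaleR_right)
  define v where "v = (DIM('a) / r) *\<^sub>R ?I - g"
  have "norm v \<le> L"
  proof (cases "v = 0")
    case False
    \<comment> \<open>Testing against the direction of the error itself turns the scalar bound into
      a bound for the norm, at no cost in the dimension.\<close>
    define u where "u = sgn v"
    have u: "norm u = 1" using False by (simp add: u_def norm_sgn)
    have "?I \<bullet> u = (\<integral>D. f (K + r *\<^sub>R D) * (D \<bullet> u) \<partial>unif_sphere)"
      using integral_inner_left[OF integrable_estimate, of u] by simp
    then have "\<bar>?I \<bullet> u - r * (g \<bullet> u) / DIM('a)\<bar> \<le> r * L / DIM('a)"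
      using directional_bias[OF u] by simp
    then have "(DIM('a) / r) * (?I \<bullet> u - r * (g \<bullet> u) / DIM('a)) \<le> (DIM('a) / r) * (r * L / DIM('a))"
      using r by (intro mult_left_mono) auto
    then have "v \<bullet> u \<le> L" using r by (simp add: v_def inner_diff_left algebra_simps)
    moreover have "v \<bullet> u = norm v"
      using False by (simp add: u_def sgn_div_norm dot_square_norm power2_eq_square)
    ultimately show ?thesis by simp
  qed (simp add: L_nonneg)
  then show ?thesis unfolding eq v_def .
qed

text \<open>The value at \<open>K - r *\<^sub>R D\<close> belongs to the one-point integrand at
  \<open>- D\<close>, which has the same law as \<open>D\<close>; the two equal halves account for
  the factor \<open>2 * r\<close>.\<close>

lemma two_point_eq_one_point:
  "(\<integral>D. ((f (K + r *\<^sub>R D) - f (K - r *\<^sub>R D)) * (DIM('a) / (2 * r))) *\<^sub>R D \<partial>unif_sphere)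
   = (\<integral>D. (f (K + r *\<^sub>R D) * (DIM('a) / r)) *\<^sub>R D \<partial>unif_sphere)"
proof -
  let ?h = "\<lambda>D. f (K + r *\<^sub>R D) *\<^sub>R D"
  let ?c = "DIM('a) / (2 * r)"
  have lin: "linear (uminus :: 'a \<Rightarrow> 'a)" by (rule linear_uminus) 
  have int: "integrable unif_sphere (\<lambda>D. ?h (- D))"
    by (rule integrable_unif_sphere_isometry[OF lin _ _ integrable_estimate]) auto
  have I: "(\<integral>D. ?h (- D) \<partial>unif_sphere) = (\<integral>D. ?h D \<partial>unif_sphere)"
    by (rule integral_unif_sphere_isometry[OF lin]) auto
  have "(\<integral>D. ((f (K + r *\<^sub>R D) - f (K - r *\<^sub>R D)) * ?c) *\<^sub>R D \<partial>unif_sphere)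
      = (\<integral>D. ?c *\<^sub>R (?h D + ?h (- D)) \<partial>unif_sphere)"
    by (intro Bochner_Integration.integral_cong) (auto simp: algebra_simps)
  also have "\<dots> = (DIM('a) / r) *\<^sub>R (\<integral>D. ?h D \<partial>unif_sphere)"
    using r by (simp add: Bochner_Integration.integral_add[OF integrable_estimate int] I
        scaleR_2[symmetric] del: scaleR_minus_right)
  also have "\<dots> = (\<integral>D. (f (K + r *\<^sub>R D) * (DIM('a) / r)) *\<^sub>R D \<partial>unif_sphere)"
    by (simp add: integral_scaleR_right[symmetric] mult.commute del: integral_scaleR_right)
  finally show ?thesis .
qed

end

section \<open>Gradient domination\<close>

text \<open>\<open>near\<close> also asserts \<open>K' \<in> S\<close>: in the application
  \<open>j\<close> has only a default value off the stabilizing gains, so membership in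
  \<open>S\<close> is tracked separately from small values of \<open>j\<close>.\<close>

locale gradient_dominated =
  fixes j :: "'a::euclidean_space \<Rightarrow> real" and grad :: "'a \<Rightarrow> 'a" and S G0 :: "'a set" and Kopt :: 'a
    and \<mu> \<phi> \<rho> \<Delta>0 :: real
  assumes derivative: "\<And>K. K \<in> S \<Longrightarrow> GDERIV j K :> grad K"
    and sublevel: "G0 = {K \<in> S. j K - j Kopt \<le> 10 * \<Delta>0}"
    and near: "\<And>K K'. K \<in> G0 \<Longrightarrow> norm (K' - K) \<le> \<rho> \<Longrightarrow>
      K' \<in> S \<and> norm (grad K' - grad K) \<le> \<phi> * norm (K' - K)"
    and domination: "\<And>K. K \<in> S \<Longrightarrow> \<mu> * (j K - j Kopt) \<le> (norm (grad K))\<^sup>2"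
    and optimal: "Kopt \<in> S" "\<And>K. K \<in> S \<Longrightarrow> K \<noteq> Kopt \<Longrightarrow> j Kopt < j K"
    and positive: "\<mu> > 0" "\<phi> > 0" "\<rho> > 0" "\<Delta>0 > 0"
begin

lemma optimal_le: "K \<in> S \<Longrightarrow> j Kopt \<le> j K"
  using optimal(2) by (cases "K = Kopt") (auto simp: less_imp_le)

lemma optimal_in_sublevel: "Kopt \<in> G0"
  using optimal(1) positive by (simp add: sublevel)

lemma sublevel_subset: "K \<in> G0 \<Longrightarrow> K \<in> S"
  by (simp add: sublevel)

text \<open>The mean value inequality, applied to \<open>j\<close> minus its linear part at
  \<open>K\<close>, compares two arbitrary points of the ball by the gradient at the centre. This is
  the form that \<open>sphere_estimate\<close> takes as input, with
  \<open>L = \<phi> * r\<close>.\<close>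

lemma near_linear:
  assumes K: "K \<in> G0" and r: "r \<le> \<rho>" and xy: "x \<in> cball K r" "y \<in> cball K r"
  shows "\<bar>j x - j y - grad K \<bullet> (x - y)\<bar> \<le> \<phi> * r * norm (x - y)"
proof -
  let ?h = "\<lambda>z. j z - grad K \<bullet> z"
  have "norm (?h x - ?h y) \<le> \<phi> * r * norm (x - y)"
  proof (rule differentiable_bound[OF convex_cball])
    fix z assume z: "z \<in> cball K r"
    then have zn: "norm (z - K) \<le> r" by (simp add: dist_norm norm_minus_commute)
    then have n: "z \<in> S" "norm (grad z - grad K) \<le> \<phi> * norm (z - K)"
      using near[OF K, of z] r by auto
    have "(j has_derivative (\<lambda>h. h \<bullet> grad z)) (at z within cball K r)"
      using derivative[OF n(1)] unfolding gderiv_def by (rule has_derivative_at_withinI)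
    then show "(?h has_derivative (\<lambda>h. h \<bullet> grad z - grad K \<bullet> h)) (at z within cball K r)"
      by (auto intro!: derivative_eq_intros)
    have "\<phi> * norm (z - K) \<le> \<phi> * r" using zn positive by (intro mult_left_mono) auto
    then show "onorm (\<lambda>h. h \<bullet> grad z - grad K \<bullet> h) \<le> \<phi> * r"
    proof (intro onorm_le)
      fix h :: 'a
      have "norm (h \<bullet> grad z - grad K \<bullet> h) = \<bar>h \<bullet> (grad z - grad K)\<bar>"
        by (simp add: inner_diff_right inner_commute)
      also have "\<dots> \<le> norm h * norm (grad z - grad K)" by (rule Cauchy_Schwarz_ineq2)
      also have "\<dots> \<le> norm h * (\<phi> * r)"
        using n(2) \<open>\<phi> * norm (z - K) \<le> \<phi> * r\<close> by (intro mult_left_mono) auto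
      finally show "norm (h \<bullet> grad z - grad K \<bullet> h) \<le> \<phi> * r * norm h" by (simp add: mult_ac)
    qed
  qed (use xy in auto)
  then show ?thesis by (simp add: inner_diff_right algebra_simps)
qed

text \<open>\<open>G0\<close> need not be convex, so gradients along the segment are compared only
  with the one at \<open>K\<close>; the segment itself has to lie in \<open>S\<close> only, which
  \<open>near\<close> provides.\<close>

lemma descent:
  assumes K: "K \<in> G0" and H: "norm H \<le> \<rho>"
  shows "j (K + H) \<le> j K + grad K \<bullet> H + \<phi> / 2 * (norm H)\<^sup>2"
proof -
  define \<psi> where "\<psi> t = j (K + t *\<^sub>R H) - t * (grad K \<bullet> H) - \<phi> / 2 * t\<^sup>2 * (norm H)\<^sup>2" for t
  have "\<psi> 1 \<le> \<psi> 0"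
  proof (rule DERIV_nonpos_imp_nonincreasing[of 0 1 \<psi>])
    fix t :: real assume t: "0 \<le> t" "t \<le> 1"
    have tH: "norm (t *\<^sub>R H) \<le> \<rho>"
      using t H by (metis abs_of_nonneg dual_order.trans mult_left_le_one_le norm_ge_zero norm_scaleR)
    have n: "K + t *\<^sub>R H \<in> S" "norm (grad (K + t *\<^sub>R H) - grad K) \<le> \<phi> * (t * norm H)"
      using near[OF K, of "K + t *\<^sub>R H"] tH t by auto
    have "((\<lambda>t. K + t *\<^sub>R H) has_derivative (\<lambda>s. s *\<^sub>R H)) (at t)"
      by (auto intro!: derivative_eq_intros)
    from has_derivative_compose[OF this derivative[OF n(1), unfolded gderiv_def]]
    have "((\<lambda>t. j (K + t *\<^sub>R H)) has_real_derivative H \<bullet> grad (K + t *\<^sub>R H)) (at t)"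
      by (simp add: has_field_derivative_def mult.commute[of _ "_ \<bullet> _"])
    then have "(\<psi> has_real_derivative
        H \<bullet> grad (K + t *\<^sub>R H) - grad K \<bullet> H - \<phi> * t * (norm H)\<^sup>2) (at t)"
      unfolding \<psi>_def by (auto intro!: derivative_eq_intros)
    moreover have "H \<bullet> grad (K + t *\<^sub>R H) - grad K \<bullet> H - \<phi> * t * (norm H)\<^sup>2 \<le> 0"
    proof -
      have "H \<bullet> grad (K + t *\<^sub>R H) - grad K \<bullet> H = H \<bullet> (grad (K + t *\<^sub>R H) - grad K)"
        by (simp add: inner_diff_right inner_commute)
      also have "\<dots> \<le> norm H * norm (grad (K + t *\<^sub>R H) - grad K)" by (rule norm_cauchy_schwarz)
      also have "\<dots> \<le> norm H * (\<phi> * (t * norm H))" by (intro mult_left_mono n) auto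
      finally show ?thesis by (simp add: power2_eq_square mult_ac)
    qed
    ultimately show "\<exists>y. (\<psi> has_real_derivative y) (at t) \<and> y \<le> 0" by blast
  qed simp
  then show ?thesis by (simp add: \<psi>_def)
qed

lemma gradient_optimal: "grad Kopt = 0"
proof -
  have "(\<lambda>h. h \<bullet> grad Kopt) = (\<lambda>h. 0)"
  proof (rule differential_zero_maxmin)
    show "Kopt \<in> ball Kopt \<rho>" "open (ball Kopt \<rho>)" using positive by auto
    show "(j has_derivative (\<lambda>h. h \<bullet> grad Kopt)) (at Kopt)"
      using derivative[OF optimal(1)] by (simp add: gderiv_def)
    have "K \<in> S" if "K \<in> ball Kopt \<rho>" for K
      using near[OF optimal_in_sublevel, of K] that by (auto simp: dist_norm norm_minus_commute)
    then show "(\<forall>K\<in>ball Kopt \<rho>. j K \<le> j Kopt) \<or> (\<forall>K\<in>ball Kopt \<rho>. j Kopt \<le> j K)"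
      using optimal_le by blast
  qed
  then show ?thesis by (metis inner_eq_zero_iff)
qed

text \<open>A gradient step of length \<open>1 / \<phi>\<close> from a point close to \<open>Kopt\<close> remains within reach of \<open>near\<close>.\<close>

lemma domination_le_smoothness: "\<mu> \<le> 2 * \<phi>"
proof -
  obtain b :: 'a where b: "b \<in> Basis" using nonempty_Basis by blast
  \<comment> \<open>The second bound gives
    \<open>\<phi> / 2 * h\<^sup>2 \<le> 10 * \<Delta>0\<close>, which keeps \<open>K\<close> in
    \<open>G0\<close>, where \<open>descent\<close> may start.\<close>
  define h where "h = min \<rho> (sqrt (20 * \<Delta>0 / \<phi>))"
  define K where "K = Kopt + h *\<^sub>R b"
  define n where "n = norm (grad K)"
  have h: "h > 0" "h \<le> \<rho>" using positive by (auto simp: h_def)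
  have "h\<^sup>2 \<le> (sqrt (20 * \<Delta>0 / \<phi>))\<^sup>2" using h(1) by (intro power_mono) (auto simp: h_def)
  also have "\<dots> = 20 * \<Delta>0 / \<phi>" using positive by simp
  finally have h2: "\<phi> / 2 * h\<^sup>2 \<le> 10 * \<Delta>0" using positive by (simp add: field_simps)
  have K: "K \<in> S" "n \<le> \<phi> * h"
    using near[OF optimal_in_sublevel, of K] b h by (auto simp: K_def n_def gradient_optimal)
  have ne: "K \<noteq> Kopt" using b h(1) by (auto simp: K_def)
  have "j K \<le> j Kopt + \<phi> / 2 * h\<^sup>2"
    using descent[OF optimal_in_sublevel, of "h *\<^sub>R b"] b h by (simp add: K_def gradient_optimal)
  with h2 K(1) have KG: "K \<in> G0" by (simp add: sublevel)
  \<comment> \<open>The minimizer of the quadratic upper bound. Comparing its value with the optimum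
    bounds the squared gradient by \<open>2 * \<phi>\<close> times the gap, the reverse of gradient
    domination.\<close>
  define H where "H = (- (1 / \<phi>)) *\<^sub>R grad K"
  have nH: "norm H = n / \<phi>" using positive by (simp add: H_def n_def)
  also have "\<dots> \<le> h" using K(2) positive by (simp add: field_simps)
  finally have H: "norm H \<le> \<rho>" using h(2) by simp
  have "K + H \<in> S" using near[OF KG, of "K + H"] H by simp
  then have "j Kopt \<le> j (K + H)" by (rule optimal_le)
  also have "\<dots> \<le> j K + grad K \<bullet> H + \<phi> / 2 * (norm H)\<^sup>2" by (rule descent[OF KG H])
  also have "grad K \<bullet> H = - (n\<^sup>2 / \<phi>)" by (simp add: H_def n_def dot_square_norm)
  also have "\<phi> / 2 * (norm H)\<^sup>2 = n\<^sup>2 / \<phi> / 2"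
    using positive by (simp add: nH power_divide power2_eq_square field_simps)
  finally have "n\<^sup>2 / \<phi> \<le> 2 * (j K - j Kopt)" by simp
  then have "n\<^sup>2 \<le> 2 * \<phi> * (j K - j Kopt)" using positive by (simp add: field_simps)
  then have "\<mu> * (j K - j Kopt) \<le> 2 * \<phi> * (j K - j Kopt)"
    using domination[OF K(1)] by (simp add: n_def)
  moreover have "j K - j Kopt > 0" using optimal(2)[OF K(1) ne] by simp
  ultimately show ?thesis by (simp only: mult_le_cancel_right_pos)
qed

text \<open>
  With \<open>w = g - grad K - e\<close> and \<open>n = G - g\<close> the increment is \<open>- \<eta> (grad K + w + n)\<close>; the descent term is
  expanded by \<open>2 grad K \<bullet> (grad K + w) = norm\<^sup>2 (grad K) + norm\<^sup>2 (grad K + w) - norm\<^sup>2 w\<close>, whose middle part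
  absorbs the quadratic error.
\<close>

lemma perturbed_step:
  assumes K: "K \<in> G0" and bias: "norm (g - grad K) \<le> b" and e: "norm e \<le> \<delta>"
    and \<eta>: "0 < \<eta>" "\<eta> \<le> 1 / (4 * \<phi>)" and bound: "\<eta> * (norm G + \<delta>) \<le> \<rho>"
    and K': "K' = K - \<eta> *\<^sub>R G + \<eta> *\<^sub>R e"
  shows "K' \<in> S" and "j K' - j Kopt \<le> (1 - \<eta> * \<mu> / 2) * (j K - j Kopt) + \<eta> / 2 * (b + \<delta>)\<^sup>2
    - \<eta> * (grad K \<bullet> (G - g)) + \<phi> * \<eta>\<^sup>2 * (norm (G - g))\<^sup>2"
proof -
  define w where "w = g - grad K - e"
  define n where "n = G - g"
  define v where "v = grad K + w"
  define H where "H = - (\<eta> *\<^sub>R (v + n))"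
  have K'H: "K' = K + H" by (simp add: K' H_def v_def w_def n_def algebra_simps)
  have "v + n = G - e" by (simp add: v_def w_def n_def)
  then have nH: "norm H = \<eta> * norm (G - e)" using \<eta>(1) by (simp add: H_def)
  also have "\<dots> \<le> \<eta> * (norm G + \<delta>)"
    using e \<eta>(1) norm_triangle_ineq4[of G e] by (intro mult_left_mono) auto
  finally have H: "norm H \<le> \<rho>" using bound by simp
  then show "K' \<in> S" using near[OF K, of K'] by (simp add: K'H)
  have "norm w \<le> b + \<delta>"
    using norm_triangle_ineq4[of "g - grad K" e] bias e by (simp add: w_def)
  then have w: "(norm w)\<^sup>2 \<le> (b + \<delta>)\<^sup>2" by (intro power_mono) auto
  have nw: "2 * (grad K \<bullet> v) = (norm (grad K))\<^sup>2 + (norm v)\<^sup>2 - (norm w)\<^sup>2"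
    by (simp add: v_def power2_norm_eq_inner inner_add_left inner_add_right inner_commute)
  \<comment> \<open>The parallelogram law disposes of the mixed term; it cannot be left to
    averaging, since \<open>v\<close> contains \<open>e\<close>, which may be correlated with
    \<open>n\<close>.\<close>
  have "(norm (v + n))\<^sup>2 + (norm (v - n))\<^sup>2 = 2 * (norm v)\<^sup>2 + 2 * (norm n)\<^sup>2"
    by (simp add: power2_norm_eq_inner inner_add_left inner_add_right inner_diff_left
        inner_diff_right inner_commute)
  then have sq: "(norm (v + n))\<^sup>2 \<le> 2 * (norm v)\<^sup>2 + 2 * (norm n)\<^sup>2"
    using zero_le_power2[of "norm (v - n)"] by linarith
  have "\<phi> / 2 * (norm H)\<^sup>2 = \<phi> / 2 * \<eta>\<^sup>2 * (norm (v + n))\<^sup>2"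
    by (simp add: H_def power_mult_distrib)
  also have "\<dots> \<le> \<phi> / 2 * \<eta>\<^sup>2 * (2 * (norm v)\<^sup>2 + 2 * (norm n)\<^sup>2)"
    using sq positive by (intro mult_left_mono) auto
  finally have q: "\<phi> / 2 * (norm H)\<^sup>2 \<le> \<phi> * \<eta>\<^sup>2 * (norm v)\<^sup>2 + \<phi> * \<eta>\<^sup>2 * (norm n)\<^sup>2"
    by (simp add: algebra_simps)
  have "\<phi> * \<eta> \<le> 1 / 4" using \<eta>(2) positive by (simp add: field_simps)
  then have "\<eta> * (\<phi> * \<eta>) \<le> \<eta> * (1 / 4)" using \<eta>(1) by (intro mult_left_mono) auto
  then have "\<phi> * \<eta>\<^sup>2 \<le> \<eta> / 2" using \<eta>(1) by (simp add: power2_eq_square mult_ac)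
  then have v: "\<phi> * \<eta>\<^sup>2 * (norm v)\<^sup>2 \<le> \<eta> / 2 * (norm v)\<^sup>2" by (intro mult_right_mono) auto
  have d: "j K' \<le> j K + grad K \<bullet> H + \<phi> / 2 * (norm H)\<^sup>2"
    unfolding K'H by (rule descent[OF K H])
  have "grad K \<bullet> H = - (\<eta> / 2) * (2 * (grad K \<bullet> v)) - \<eta> * (grad K \<bullet> n)"
    by (simp add: H_def inner_add_right algebra_simps)
  then have i: "grad K \<bullet> H = - (\<eta> / 2) * (norm (grad K))\<^sup>2 - \<eta> / 2 * (norm v)\<^sup>2 + \<eta> / 2 * (norm w)\<^sup>2
      - \<eta> * (grad K \<bullet> n)"
    unfolding nw by (simp add: algebra_simps)
  have dom: "\<eta> / 2 * (\<mu> * (j K - j Kopt)) \<le> \<eta> / 2 * (norm (grad K))\<^sup>2"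
    using domination[OF sublevel_subset[OF K]] \<eta>(1) by (intro mult_left_mono) auto
  have w': "\<eta> / 2 * (norm w)\<^sup>2 \<le> \<eta> / 2 * (b + \<delta>)\<^sup>2" using w \<eta>(1) by (intro mult_left_mono) auto
  have "j K' - j Kopt \<le> (j K - j Kopt) - \<eta> / 2 * (\<mu> * (j K - j Kopt)) + \<eta> / 2 * (b + \<delta>)\<^sup>2
    - \<eta> * (grad K \<bullet> n) + \<phi> * \<eta>\<^sup>2 * (norm n)\<^sup>2"
    using d i q v dom w' by linarith
  moreover have "(1 - \<eta> * \<mu> / 2) * x = x - \<eta> / 2 * (\<mu> * x)" for x
    by (simp add: algebra_simps)
  ultimately show "j K' - j Kopt \<le> (1 - \<eta> * \<mu> / 2) * (j K - j Kopt) + \<eta> / 2 * (b + \<delta>)\<^sup>2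
    - \<eta> * (grad K \<bullet> (G - g)) + \<phi> * \<eta>\<^sup>2 * (norm (G - g))\<^sup>2"
    by (simp add: n_def)
qed

end

section \<open>Perturbed stochastic descent\<close>

definition stays :: "'a set \<Rightarrow> (nat \<Rightarrow> 'w \<Rightarrow> 'a) \<Rightarrow> nat \<Rightarrow> 'w \<Rightarrow> bool" where
  "stays G0 K s \<omega> \<longleftrightarrow> (\<forall>i\<le>s. K i \<omega> \<in> G0)"

text \<open>Depends on the iterates up to time \<open>s\<close> only, hence on the past of step
  \<open>s\<close>. If \<open>p\<close> lies in \<open>G0\<close>, the values never leave
  \<open>G0\<close>, so bounds valid there apply at all times.\<close>

definition stopped :: "'a set \<Rightarrow> 'a \<Rightarrow> (nat \<Rightarrow> 'w \<Rightarrow> 'a) \<Rightarrow> nat \<Rightarrow> 'w \<Rightarrow> 'a" where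
  "stopped G0 p K s \<omega> = (if stays G0 K s \<omega> then K s \<omega> else p)"

lemma measurable_stays:
  assumes "\<And>i. i \<le> s \<Longrightarrow> K i \<in> borel_measurable M" and [measurable]: "G0 \<in> sets borel"
  shows "Measurable.pred M (stays G0 K s)"
proof -
  have [measurable]: "K i \<in> borel_measurable M" if "i \<in> {..s}" for i using assms(1) that by simp
  have "Measurable.pred M (\<lambda>\<omega>. \<forall>i\<in>{..s}. K i \<omega> \<in> G0)" by measurable
  then show ?thesis by (simp add: stays_def[abs_def])
qed

lemma measurable_stopped:
  fixes K :: "nat \<Rightarrow> 'w \<Rightarrow> 'a::topological_space"
  assumes "\<And>i. i \<le> s \<Longrightarrow> K i \<in> borel_measurable M" "G0 \<in> sets borel"
  shows "stopped G0 p K s \<in> borel_measurable M"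
proof -
  note [measurable] = measurable_stays[OF assms] assms(1)[OF order_refl]
  show ?thesis unfolding stopped_def[abs_def] by measurable
qed

text \<open>
  An iterate that leaves \<open>G0\<close> is moved to the optimum: the gradient vanishes there, so the noise of
  the later steps has no effect.
\<close>

locale perturbed_descent = gradient_dominated j grad S G0 Kopt \<mu> \<phi> \<rho> \<Delta>0 +
  M: prob_space M + N: prob_space N
  for j :: "'a::euclidean_space \<Rightarrow> real" and grad S G0 Kopt \<mu> \<phi> \<rho> \<Delta>0
    and M :: "'w measure" and N :: "'y measure" +
  fixes G :: "'a \<Rightarrow> 'y \<Rightarrow> 'a" and K :: "nat \<Rightarrow> 'w \<Rightarrow> 'a" and W :: "nat \<Rightarrow> 'w \<Rightarrow> 'y"
    and E :: "nat \<Rightarrow> 'w \<Rightarrow> 'a" and K0 :: 'a and T :: nat and \<eta> b \<delta> ginf g2 :: real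
  assumes measurable_domain [measurable]: "S \<in> sets borel"
    and measurable_sublevel [measurable]: "G0 \<in> sets borel"
    and measurable_grad [measurable]: "(\<lambda>K. indicator G0 K *\<^sub>R grad K) \<in> borel_measurable borel"
    and measurable_cost [measurable]: "j \<in> borel_measurable borel"
    and measurable_G [measurable]: "case_prod G \<in> borel_measurable (borel \<Otimes>\<^sub>M N)"
    and measurable_K [measurable]: "\<And>s. s \<le> T \<Longrightarrow> K s \<in> borel_measurable M"
    and measurable_W [measurable]: "\<And>s. s < T \<Longrightarrow> W s \<in> measurable M N"
    and bias: "\<And>K. K \<in> G0 \<Longrightarrow> norm ((\<integral>y. G K y \<partial>N) - grad K) \<le> b"
    and bound: "\<And>K. K \<in> G0 \<Longrightarrow> AE y in N. norm (G K y) \<le> ginf"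
    and var: "\<And>K. K \<in> G0 \<Longrightarrow>
      (\<integral>\<^sup>+y. ennreal ((norm (G K y - (\<integral>y. G K y \<partial>N)))\<^sup>2) \<partial>N) \<le> ennreal g2"
    and g2: "g2 \<ge> 0"
    and fresh: "\<And>s. s < T \<Longrightarrow>
      distr M (borel \<Otimes>\<^sub>M N) (\<lambda>\<omega>. (stopped G0 Kopt K s \<omega>, W s \<omega>))
        = distr M borel (stopped G0 Kopt K s) \<Otimes>\<^sub>M N"
    and initial: "\<And>\<omega>. \<omega> \<in> space M \<Longrightarrow> K 0 \<omega> = K0" "K0 \<in> G0" "j K0 - j Kopt = \<Delta>0"
    and recursion: "\<And>s. s < T \<Longrightarrow> AE \<omega> in M. stays G0 K s \<omega> \<longrightarrow>
      K (Suc s) \<omega> = K s \<omega> - \<eta> *\<^sub>R G (K s \<omega>) (W s \<omega>) + \<eta> *\<^sub>R E s \<omega>"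
    and perturbation: "\<And>s. s < T \<Longrightarrow> AE \<omega> in M. norm (E s \<omega>) \<le> \<delta>"
    and stepsize: "0 < \<eta>" "\<eta> \<le> 1 / (4 * \<phi>)" "\<eta> * (ginf + \<delta>) \<le> \<rho>"
begin

abbreviation stay :: "nat \<Rightarrow> 'w \<Rightarrow> bool" where "stay \<equiv> stays G0 K"

abbreviation iterate :: "nat \<Rightarrow> 'w \<Rightarrow> 'a" where "iterate \<equiv> stopped G0 Kopt K"

abbreviation mean :: "'a \<Rightarrow> 'a" where "mean k \<equiv> \<integral>y. G k y \<partial>N"

definition drift :: real where "drift = \<eta> / 2 * (b + \<delta>)\<^sup>2 + \<phi> * \<eta>\<^sup>2 * g2"

definition gap :: "nat \<Rightarrow> real" where "gap s = (\<integral>\<omega>. j (iterate s \<omega>) - j Kopt \<partial>M)"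

lemma measurable_mean [measurable]: "mean \<in> borel_measurable borel"
  using measurable_G by measurable

lemma measurable_stay [measurable]: "s \<le> T \<Longrightarrow> Measurable.pred M (stay s)"
  by (rule measurable_stays) auto

lemma measurable_iterate [measurable]: "s \<le> T \<Longrightarrow> iterate s \<in> borel_measurable M"
  by (rule measurable_stopped) auto

lemma iterate_in_sublevel: "iterate s \<omega> \<in> G0"
  using optimal_in_sublevel by (auto simp: stopped_def stays_def)

lemma cost_bounds: "k \<in> G0 \<Longrightarrow> 0 \<le> j k - j Kopt" "k \<in> G0 \<Longrightarrow> j k - j Kopt \<le> 10 * \<Delta>0"
  using optimal_le by (auto simp: sublevel)

lemma integrable_gap:
  assumes "s \<le> T" shows "integrable M (\<lambda>\<omega>. j (iterate s \<omega>) - j Kopt)"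
proof (rule M.integrable_const_bound)
  show "AE \<omega> in M. norm (j (iterate s \<omega>) - j Kopt) \<le> 10 * \<Delta>0"
    using cost_bounds[OF iterate_in_sublevel] by (intro AE_I2) (simp add: abs_le_iff)
qed (use assms in measurable)

lemma gap_nonneg: "gap s \<ge> 0"
  unfolding gap_def by (intro integral_nonneg_AE AE_I2 cost_bounds iterate_in_sublevel)

lemma gap_0: "gap 0 = \<Delta>0"
proof -
  have "gap 0 = (\<integral>\<omega>. \<Delta>0 \<partial>M)"
    unfolding gap_def using initial
    by (intro Bochner_Integration.integral_cong) (auto simp: stopped_def stays_def)
  then show ?thesis by (simp add: M.prob_space)
qed

lemma prob_stay_0: "M.prob {\<omega> \<in> space M. stay 0 \<omega>} = 1"
  using initial by (intro M.prob_eq_1[THEN iffD2]) (auto simp: stays_def)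

lemma integrable_G: "k \<in> G0 \<Longrightarrow> integrable N (G k)"
  by (rule N.integrable_const_bound[OF bound]) measurable

text \<open>The indicator secures measurability, as the gradient is controlled on \<open>G0\<close>
  only; stopped iterates lie in \<open>G0\<close>, where it equals 1.\<close>

definition noise :: "'a \<Rightarrow> 'y \<Rightarrow> real" where
  "noise k y = (indicator G0 k *\<^sub>R grad k) \<bullet> (G k y - mean k)"

definition energy :: "'a \<Rightarrow> 'y \<Rightarrow> real" where
  "energy k y = (norm (G k y - mean k))\<^sup>2"

lemma measurable_noise [measurable]: "case_prod noise \<in> borel_measurable (borel \<Otimes>\<^sub>M N)"
  unfolding noise_def by measurable

lemma measurable_energy [measurable]: "case_prod energy \<in> borel_measurable (borel \<Otimes>\<^sub>M N)"
  unfolding energy_def by measurable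

lemma measurable_pair [measurable]:
  "s < T \<Longrightarrow> (\<lambda>\<omega>. (iterate s \<omega>, W s \<omega>)) \<in> measurable M (borel \<Otimes>\<^sub>M N)"
  by measurable

text \<open>The exceptional null set varies with \<open>k\<close>, so the property cannot simply be
  applied at a random iterate. Under the product law from \<open>fresh\<close> the set of bad pairs
  is null by Fubini.\<close>

lemma AE_fresh:
  assumes s: "s < T" and P[measurable]: "Measurable.pred (borel \<Otimes>\<^sub>M N) (case_prod P)"
    and AE: "\<And>k. k \<in> G0 \<Longrightarrow> AE y in N. P k y"
  shows "AE \<omega> in M. P (iterate s \<omega>) (W s \<omega>)"
proof -
  let ?L = "distr M borel (iterate s)"
  have m: "iterate s \<in> borel_measurable M" using s by measurable
  interpret L: prob_space ?L by (rule M.prob_space_distr[OF m])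
  interpret LN: pair_prob_space ?L N ..
  have "AE x in ?L \<Otimes>\<^sub>M N. case_prod P x"
  proof (rule LN.AE_pair_measure)
    show "{x \<in> space (?L \<Otimes>\<^sub>M N). case_prod P x} \<in> sets (?L \<Otimes>\<^sub>M N)" by measurable
    have "AE k in ?L. k \<in> G0"
      using m iterate_in_sublevel by (subst AE_distr_iff) auto
    then show "AE k in ?L. AE y in N. case_prod P (k, y)"
      by eventually_elim (simp add: AE)
  qed
  then have "AE x in distr M (borel \<Otimes>\<^sub>M N) (\<lambda>\<omega>. (iterate s \<omega>, W s \<omega>)). case_prod P x"
    unfolding fresh[OF s] .
  then show ?thesis
    by (subst (asm) AE_distr_iff) (use s in \<open>auto intro: measurable_pair\<close>)
qed

lemma bound_fresh:
  assumes "s < T" shows "AE \<omega> in M. norm (G (iterate s \<omega>) (W s \<omega>)) \<le> ginf"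
  by (rule AE_fresh[OF assms _ bound]) measurable

text \<open>Fubini for the product law in place of conditional expectation: the draw is integrated
  out first, with the iterate held fixed in \<open>G0\<close>.\<close>

lemma integral_fresh:
  fixes h :: "'a \<Rightarrow> 'y \<Rightarrow> real"
  assumes s: "s < T" and h[measurable]: "case_prod h \<in> borel_measurable (borel \<Otimes>\<^sub>M N)"
    and int: "integrable M (\<lambda>\<omega>. h (iterate s \<omega>) (W s \<omega>))"
    and le: "\<And>k. k \<in> G0 \<Longrightarrow> (\<integral>y. h k y \<partial>N) \<le> c"
  shows "(\<integral>\<omega>. h (iterate s \<omega>) (W s \<omega>) \<partial>M) \<le> c"
proof -
  let ?L = "distr M borel (iterate s)"
  have m: "iterate s \<in> borel_measurable M" using s by measurable
  interpret L: prob_space ?L by (rule M.prob_space_distr[OF m])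
  interpret LN: pair_prob_space ?L N ..
  have "(\<integral>\<omega>. h (iterate s \<omega>) (W s \<omega>) \<partial>M)
      = (\<integral>x. case_prod h x \<partial>distr M (borel \<Otimes>\<^sub>M N) (\<lambda>\<omega>. (iterate s \<omega>, W s \<omega>)))"
    using s by (subst integral_distr) auto
  also have "\<dots> = (\<integral>x. case_prod h x \<partial>(?L \<Otimes>\<^sub>M N))" by (simp add: fresh[OF s])
  finally have eq: "(\<integral>\<omega>. h (iterate s \<omega>) (W s \<omega>) \<partial>M) = (\<integral>x. case_prod h x \<partial>(?L \<Otimes>\<^sub>M N))" .
  have "integrable (distr M (borel \<Otimes>\<^sub>M N) (\<lambda>\<omega>. (iterate s \<omega>, W s \<omega>))) (case_prod h)"
    using s int by (subst integrable_distr_eq) auto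
  then have i: "integrable (?L \<Otimes>\<^sub>M N) (case_prod h)" by (simp add: fresh[OF s])
  have "(\<integral>x. case_prod h x \<partial>(?L \<Otimes>\<^sub>M N)) = (\<integral>k. \<integral>y. h k y \<partial>N \<partial>?L)"
    using LN.integral_fst[OF i] by simp
  also have "\<dots> \<le> (\<integral>k. c \<partial>?L)"
  proof (rule integral_mono_AE)
    show "integrable ?L (\<lambda>k. \<integral>y. h k y \<partial>N)" by (rule LN.integrable_fst[OF i])
    have "AE k in ?L. k \<in> G0"
      using m iterate_in_sublevel by (subst AE_distr_iff) auto
    then show "AE k in ?L. (\<integral>y. h k y \<partial>N) \<le> c" by eventually_elim (rule le)
  qed simp
  also have "\<dots> = c" using L.prob_space by simp
  finally show ?thesis using eq by simp
qed

lemma mean_bound: "k \<in> G0 \<Longrightarrow> norm (mean k) \<le> ginf"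
proof -
  assume k: "k \<in> G0"
  have "norm (mean k) \<le> (\<integral>y. norm (G k y) \<partial>N)" by (rule integral_norm_bound)
  also have "\<dots> \<le> (\<integral>y. ginf \<partial>N)"
    using integrable_G[OF k] bound[OF k] by (intro integral_mono_AE) auto
  finally show ?thesis by (simp add: N.prob_space)
qed

text \<open>Obtained from the mean of the estimates and their bias; it supplies the bound that makes
  the noise integrable.\<close>

lemma grad_bound: "k \<in> G0 \<Longrightarrow> norm (grad k) \<le> ginf + b"
  using bias[of k] mean_bound[of k] norm_triangle_ineq4[of "mean k" "mean k - grad k"] by simp

lemma integrable_noise:
  assumes s: "s < T" shows "integrable M (\<lambda>\<omega>. noise (iterate s \<omega>) (W s \<omega>))"
proof (rule M.integrable_const_bound)
  show "AE \<omega> in M. norm (noise (iterate s \<omega>) (W s \<omega>)) \<le> (ginf + b) * (ginf + ginf)"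
    using bound_fresh[OF s]
  proof eventually_elim
    case (elim \<omega>)
    let ?k = "iterate s \<omega>"
    have "norm (G ?k (W s \<omega>) - mean ?k) \<le> ginf + ginf"
      using norm_triangle_ineq4[of "G ?k (W s \<omega>)" "mean ?k"] elim
        mean_bound[OF iterate_in_sublevel, of s \<omega>] by simp
    moreover have "norm (grad ?k) \<le> ginf + b" by (rule grad_bound[OF iterate_in_sublevel])
    ultimately have "norm (grad ?k) * norm (G ?k (W s \<omega>) - mean ?k) \<le> (ginf + b) * (ginf + ginf)"
      by (intro mult_mono) (auto intro: order_trans[OF norm_ge_zero])
    then show ?case
      using Cauchy_Schwarz_ineq2[of "grad ?k" "G ?k (W s \<omega>) - mean ?k"]
      by (simp add: noise_def iterate_in_sublevel)
  qed
qed (use s in measurable)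

lemma integrable_energy:
  assumes s: "s < T" shows "integrable M (\<lambda>\<omega>. energy (iterate s \<omega>) (W s \<omega>))"
proof (rule M.integrable_const_bound)
  show "AE \<omega> in M. norm (energy (iterate s \<omega>) (W s \<omega>)) \<le> (ginf + ginf)\<^sup>2"
    using bound_fresh[OF s]
  proof eventually_elim
    case (elim \<omega>)
    let ?k = "iterate s \<omega>"
    have "norm (G ?k (W s \<omega>) - mean ?k) \<le> ginf + ginf"
      using norm_triangle_ineq4[of "G ?k (W s \<omega>)" "mean ?k"] elim
        mean_bound[OF iterate_in_sublevel, of s \<omega>] by simp
    then have "(norm (G ?k (W s \<omega>) - mean ?k))\<^sup>2 \<le> (ginf + ginf)\<^sup>2" by (rule power_mono) simp
    then show ?case by (simp only: energy_def real_norm_def abs_power2)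
  qed
qed (use s in measurable)

text \<open>The noise enters the one-step bound with a minus sign, and \<open>integral_fresh\<close>
  yields upper bounds, whence the sign here.\<close>

lemma expectation_noise:
  assumes s: "s < T" shows "(\<integral>\<omega>. - noise (iterate s \<omega>) (W s \<omega>) \<partial>M) \<le> 0"
proof (rule integral_fresh[OF s])
  show "(\<lambda>(k, y). - noise k y) \<in> borel_measurable (borel \<Otimes>\<^sub>M N)" by measurable
  show "integrable M (\<lambda>\<omega>. - noise (iterate s \<omega>) (W s \<omega>))" using integrable_noise[OF s] by simp
  fix k assume k: "k \<in> G0"
  have "(\<integral>y. noise k y \<partial>N) = grad k \<bullet> (\<integral>y. G k y - mean k \<partial>N)"
    using k integrable_G[OF k] by (simp add: noise_def)
  also have "(\<integral>y. G k y - mean k \<partial>N) = 0"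
    using integrable_G[OF k] by (simp add: N.prob_space)
  finally show "(\<integral>y. - noise k y \<partial>N) \<le> 0" by simp
qed

lemma expectation_energy:
  assumes s: "s < T" shows "(\<integral>\<omega>. energy (iterate s \<omega>) (W s \<omega>) \<partial>M) \<le> g2"
proof (rule integral_fresh[OF s measurable_energy integrable_energy[OF s]])
  fix k assume k: "k \<in> G0"
  show "(\<integral>y. energy k y \<partial>N) \<le> g2"
    using var[OF k] g2 by (intro integral_real_bounded) (auto simp: energy_def)
qed

lemma gap_step:
  assumes s: "s < T"
  shows "gap (Suc s) + 10 * \<Delta>0 *
      (M.prob {\<omega> \<in> space M. stay s \<omega>} - M.prob {\<omega> \<in> space M. stay (Suc s) \<omega>})
    \<le> (1 - \<eta> * \<mu> / 2) * gap s + drift"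
proof -
  let ?exit = "{\<omega> \<in> space M. stay s \<omega> \<and> \<not> stay (Suc s) \<omega>}"
  let ?n = "\<lambda>\<omega>. noise (iterate s \<omega>) (W s \<omega>)" and ?v = "\<lambda>\<omega>. energy (iterate s \<omega>) (W s \<omega>)"
  have [measurable]: "Measurable.pred M (stay s)" "Measurable.pred M (stay (Suc s))"
    using s by auto
  have exit: "?exit \<in> sets M" by measurable
  have stay_mono: "stay s \<omega>" if "stay (Suc s) \<omega>" for \<omega> using that by (auto simp: stays_def)
  have diff: "M.prob {\<omega> \<in> space M. stay s \<omega>} - M.prob {\<omega> \<in> space M. stay (Suc s) \<omega>} = M.prob ?exit"
    using stay_mono
    by (subst M.finite_measure_Diff[symmetric]) (auto intro!: arg_cong[where f = M.prob])
  have pointwise: "AE \<omega> in M. (j (iterate (Suc s) \<omega>) - j Kopt) + 10 * \<Delta>0 * indicator ?exit \<omega>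
      \<le> (1 - \<eta> * \<mu> / 2) * (j (iterate s \<omega>) - j Kopt) + \<eta> / 2 * (b + \<delta>)\<^sup>2
        + \<eta> * (- ?n \<omega>) + \<phi> * \<eta>\<^sup>2 * ?v \<omega>"
    using recursion[OF s] perturbation[OF s] bound_fresh[OF s]
  proof eventually_elim
    case (elim \<omega>)
    show ?case
    proof (cases "stay s \<omega>")
      case True
      let ?k = "K s \<omega>" and ?G = "G (K s \<omega>) (W s \<omega>)"
      have k: "?k \<in> G0" "iterate s \<omega> = ?k" using True by (auto simp: stopped_def stays_def)
      have "\<eta> * (norm ?G + \<delta>) \<le> \<eta> * (ginf + \<delta>)"
        using elim(3) stepsize(1) by (simp add: k)
      then have "\<eta> * (norm ?G + \<delta>) \<le> \<rho>" using stepsize(3) by simp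
      note st = perturbed_step[OF k(1) bias[OF k(1)] elim(2) stepsize(1,2) this
          elim(1)[rule_format, OF True]]
      \<comment> \<open>On exit the stopped gap drops to 0, while the actual iterate lies in
        \<open>S\<close> outside \<open>G0\<close> and has a gap above
        \<open>10 * \<Delta>0\<close>; this difference pays for the indicator.\<close>
      have "(j (iterate (Suc s) \<omega>) - j Kopt) + 10 * \<Delta>0 * indicator ?exit \<omega> \<le> j (K (Suc s) \<omega>) - j Kopt"
      proof (cases "stay (Suc s) \<omega>")
        case True then show ?thesis by (simp add: stopped_def)
      next
        case False
        then have "K (Suc s) \<omega> \<notin> G0" using True by (auto simp: stays_def le_Suc_eq)
        then have "10 * \<Delta>0 < j (K (Suc s) \<omega>) - j Kopt" using st(1) by (auto simp: sublevel)
        then show ?thesis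
          using False positive by (auto simp: stopped_def indicator_def)
      qed
      with st(2) show ?thesis by (simp add: k noise_def energy_def)
    next
      \<comment> \<open>After an exit both stopped iterates are \<open>Kopt\<close>, where gap and
        gradient vanish; only nonnegative terms remain on the right.\<close>
      case False
      then have "\<not> stay (Suc s) \<omega>" using stay_mono by blast
      with False positive stepsize(1) show ?thesis
        by (simp add: stopped_def noise_def energy_def gradient_optimal indicator_def)
    qed
  qed
  note int = integrable_gap[of s] integrable_gap[of "Suc s"] integrable_noise[OF s] integrable_energy[OF s]
  have n: "\<eta> * (\<integral>\<omega>. - ?n \<omega> \<partial>M) \<le> \<eta> * 0"
    using stepsize(1) by (intro mult_left_mono expectation_noise s) simp
  have v: "\<phi> * \<eta>\<^sup>2 * (\<integral>\<omega>. ?v \<omega> \<partial>M) \<le> \<phi> * \<eta>\<^sup>2 * g2"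
    using positive by (intro mult_left_mono expectation_energy s) simp
  have affine: "(\<integral>\<omega>. p * X \<omega> + q + u * Y \<omega> + v * Z \<omega> \<partial>M)
      = p * (\<integral>\<omega>. X \<omega> \<partial>M) + q + u * (\<integral>\<omega>. Y \<omega> \<partial>M) + v * (\<integral>\<omega>. Z \<omega> \<partial>M)"
    if "integrable M X" "integrable M Y" "integrable M Z" for p q u v :: real and X Y Z
    using that by (simp add: M.prob_space)
  have int_exit: "integrable M (\<lambda>\<omega>. 10 * \<Delta>0 * indicator ?exit \<omega> :: real)"
    by (intro integrable_mult_right integrable_real_indicator exit) (simp add: M.emeasure_eq_measure)
  have int_lhs: "integrable M
      (\<lambda>\<omega>. (j (iterate (Suc s) \<omega>) - j Kopt) + 10 * \<Delta>0 * indicator ?exit \<omega>)"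
    using int s by (intro Bochner_Integration.integrable_add int_exit) simp
  have "gap (Suc s) + 10 * \<Delta>0 * M.prob ?exit
      = (\<integral>\<omega>. (j (iterate (Suc s) \<omega>) - j Kopt) + 10 * \<Delta>0 * indicator ?exit \<omega> \<partial>M)"
    unfolding gap_def
    by (subst Bochner_Integration.integral_add) (use int s exit in \<open>auto simp: M.emeasure_eq_measure\<close>)
  also have "\<dots> \<le> (\<integral>\<omega>. (1 - \<eta> * \<mu> / 2) * (j (iterate s \<omega>) - j Kopt) + \<eta> / 2 * (b + \<delta>)\<^sup>2
        + \<eta> * (- ?n \<omega>) + \<phi> * \<eta>\<^sup>2 * ?v \<omega> \<partial>M)"
    using int s by (intro integral_mono_AE[OF int_lhs _ pointwise]) auto
  also have "\<dots> = (1 - \<eta> * \<mu> / 2) * gap s + \<eta> / 2 * (b + \<delta>)\<^sup>2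
      + \<eta> * (\<integral>\<omega>. - ?n \<omega> \<partial>M) + \<phi> * \<eta>\<^sup>2 * (\<integral>\<omega>. ?v \<omega> \<partial>M)"
    unfolding gap_def using int s by (intro affine) auto
  also have "\<dots> \<le> (1 - \<eta> * \<mu> / 2) * gap s + \<eta> / 2 * (b + \<delta>)\<^sup>2 + \<eta> * 0 + \<phi> * \<eta>\<^sup>2 * g2"
    by (intro add_mono order_refl n v)
  finally show ?thesis by (simp add: diff drift_def)
qed

section \<open>From one step to \<open>T\<close> steps\<close>

lemma rate_bounds: "0 < \<eta> * \<mu> / 2" "\<eta> * \<mu> / 2 \<le> 1"
proof -
  show "0 < \<eta> * \<mu> / 2" using stepsize(1) positive by simp
  \<comment> \<open>This keeps the factor \<open>1 - \<eta> * \<mu> / 2\<close> nonnegative, so that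
    the one-step inequality can be iterated.\<close>
  have "\<eta> * \<mu> \<le> 1 / (4 * \<phi>) * (2 * \<phi>)"
    using stepsize domination_le_smoothness positive by (intro mult_mono) auto
  then show "\<eta> * \<mu> / 2 \<le> 1" using positive by simp
qed

lemma drift_nonneg: "drift \<ge> 0"
  using stepsize(1) positive g2 by (simp add: drift_def)

lemma gap_geometric:
  "s \<le> T \<Longrightarrow> gap s \<le> (1 - \<eta> * \<mu> / 2) ^ s * \<Delta>0 + drift / (\<eta> * \<mu> / 2)"
proof (induction s)
  case 0
  then show ?case using gap_0 drift_nonneg rate_bounds(1) by simp
next
  case (Suc s)
  let ?a = "\<eta> * \<mu> / 2"
  have "M.prob {\<omega> \<in> space M. stay (Suc s) \<omega>} \<le> M.prob {\<omega> \<in> space M. stay s \<omega>}"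
    using Suc.prems by (intro M.finite_measure_mono) (auto simp: stays_def)
  then have "0 \<le> 10 * \<Delta>0 * (M.prob {\<omega> \<in> space M. stay s \<omega>} - M.prob {\<omega> \<in> space M. stay (Suc s) \<omega>})"
    using positive by simp
  then have "gap (Suc s) \<le> (1 - ?a) * gap s + drift" using gap_step[of s] Suc.prems by simp
  also have "\<dots> \<le> (1 - ?a) * ((1 - ?a) ^ s * \<Delta>0 + drift / ?a) + drift"
    using Suc rate_bounds by (intro add_right_mono mult_left_mono) auto
  also have "\<dots> = (1 - ?a) ^ Suc s * \<Delta>0 + ((1 - ?a) * (drift / ?a) + drift)"
    by (simp only: distrib_left add.assoc power_Suc mult.assoc)
  \<comment> \<open>\<open>drift / (\<eta> * \<mu> / 2)\<close> is the fixed point of the affine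
    one-step map.\<close>
  also have "(1 - a) * (x / a) + x = x / a" if "0 < a" for a x :: real
    using that by (simp add: field_simps)
  note this[OF rate_bounds(1)]
  finally show ?case .
qed

text \<open>Where \<open>gap_geometric\<close> drops the exit term and keeps the contraction, here
  the contraction is given up and the exit terms, which telescope, are kept.\<close>

lemma gap_exit:
  "s \<le> T \<Longrightarrow> gap s + 10 * \<Delta>0 * (1 - M.prob {\<omega> \<in> space M. stay s \<omega>}) \<le> \<Delta>0 + s * drift"
proof (induction s)
  case 0
  then show ?case by (simp add: gap_0 prob_stay_0)
next
  case (Suc s)
  have "(1 - \<eta> * \<mu> / 2) * gap s \<le> 1 * gap s"
    using rate_bounds gap_nonneg by (intro mult_right_mono) auto
  then show ?case using Suc gap_step[of s] by (simp add: algebra_simps)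
qed

text \<open>Failure means that the path left \<open>G0\<close> or that the stopped iterate has a gap
  of at least \<open>\<epsilon>\<close>; the two summands bound these events. The event demands
  \<open>K T \<omega> \<in> S\<close> because a small \<open>j\<close> says nothing off
  \<open>S\<close>.\<close>

theorem success_probability:
  assumes "\<epsilon> > 0"
  shows "1 - M.prob {\<omega> \<in> space M. K T \<omega> \<in> S \<and> j (K T \<omega>) - j Kopt < \<epsilon>}
    \<le> (\<Delta>0 + T * drift) / (10 * \<Delta>0) + ((1 - \<eta> * \<mu> / 2) ^ T * \<Delta>0 + drift / (\<eta> * \<mu> / 2)) / \<epsilon>"
proof -
  let ?stay = "{\<omega> \<in> space M. stay T \<omega>}"
  let ?late = "{\<omega> \<in> space M. \<epsilon> \<le> j (iterate T \<omega>) - j Kopt}"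
  let ?good = "{\<omega> \<in> space M. K T \<omega> \<in> S \<and> j (K T \<omega>) - j Kopt < \<epsilon>}"
  have [measurable]: "iterate T \<in> borel_measurable M" "Measurable.pred M (stay T)"
    "K T \<in> borel_measurable M" by auto
  have late: "M.prob ?late \<le> gap T / \<epsilon>"
    unfolding gap_def using integrable_gap assms cost_bounds[OF iterate_in_sublevel]
    by (intro integral_Markov_inequality_measure[where A = "{}"]) auto
  have S: "{\<omega> \<in> space M. stay T \<omega> \<and> j (iterate T \<omega>) - j Kopt < \<epsilon>} \<subseteq> ?good"
    by (auto simp: stopped_def stays_def sublevel_subset)
  have good: "?good \<in> sets M" by measurable
  have "1 = M.prob (space M)" by (simp add: M.prob_space)
  also have "\<dots> \<le> M.prob ((space M - ?stay) \<union> (?late \<union> ?good))"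
    using S good by (intro M.finite_measure_mono) auto
  also have "\<dots> \<le> M.prob (space M - ?stay) + M.prob (?late \<union> ?good)"
    using good by (intro measure_Un_le) measurable
  also have "M.prob (?late \<union> ?good) \<le> M.prob ?late + M.prob ?good"
    using good by (intro measure_Un_le) measurable
  also have "M.prob (space M - ?stay) = 1 - M.prob ?stay"
    by (intro M.prob_compl) measurable
  finally have *: "1 - M.prob ?good \<le> (1 - M.prob ?stay) + M.prob ?late" by simp
  have "10 * \<Delta>0 * (1 - M.prob ?stay) \<le> \<Delta>0 + T * drift"
    using gap_exit[of T] gap_nonneg[of T] by simp
  then have "1 - M.prob ?stay \<le> (\<Delta>0 + T * drift) / (10 * \<Delta>0)"
    using positive by (simp add: pos_le_divide_eq mult.commute)
  moreover have "M.prob ?late \<le> ((1 - \<eta> * \<mu> / 2) ^ T * \<Delta>0 + drift / (\<eta> * \<mu> / 2)) / \<epsilon>"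
    using gap_geometric[of T] assms by (intro order_trans[OF late] divide_right_mono) auto
  ultimately show ?thesis using * by linarith
qed

end

section \<open>The linear quadratic regulator\<close>

text \<open>Independence is given for the whole past, whereas only a function \<open>h\<close> of it
  is paired with the draw. Preimages under \<open>h\<close> stay in the sigma-algebra of
  \<open>Y\<close>, so the joint law factorizes on rectangles, which determine it.\<close>

lemma (in prob_space) indep_rv_distr_pair:
  assumes indep: "indep_rv M N Y N' Z"
    and Y[measurable]: "Y \<in> measurable M N" and Z[measurable]: "Z \<in> measurable M N'"
    and h[measurable]: "h \<in> measurable N L"
  shows "distr M (L \<Otimes>\<^sub>M N') (\<lambda>\<omega>. (h (Y \<omega>), Z \<omega>)) = distr M L (\<lambda>\<omega>. h (Y \<omega>)) \<Otimes>\<^sub>M distr M N' Z"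
proof (rule pair_measure_eqI[symmetric])
  interpret L: prob_space "distr M L (\<lambda>\<omega>. h (Y \<omega>))" by (rule prob_space_distr) measurable
  interpret N': prob_space "distr M N' Z" by (rule prob_space_distr) measurable
  show "sigma_finite_measure (distr M L (\<lambda>\<omega>. h (Y \<omega>)))" "sigma_finite_measure (distr M N' Z)"
    by unfold_locales
  fix S S' assume "S \<in> sets (distr M L (\<lambda>\<omega>. h (Y \<omega>)))" "S' \<in> sets (distr M N' Z)"
  then have S[measurable]: "S \<in> sets L" "S' \<in> sets N'" by auto
  have "h -` S \<inter> space N \<in> sets N" by measurable
  then have 1: "Y -` (h -` S \<inter> space N) \<inter> space M \<in> sets (vimage_algebra (space M) Y N)"
    by (rule in_vimage_algebra)
  have 2: "Z -` S' \<inter> space M \<in> sets (vimage_algebra (space M) Z N')"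
    using S(2) by (rule in_vimage_algebra)
  have eq: "Y -` (h -` S \<inter> space N) \<inter> space M = (\<lambda>\<omega>. h (Y \<omega>)) -` S \<inter> space M"
    using measurable_space[OF Y] by auto
  have "prob (((\<lambda>\<omega>. h (Y \<omega>)) -` S \<inter> space M) \<inter> (Z -` S' \<inter> space M))
      = prob ((\<lambda>\<omega>. h (Y \<omega>)) -` S \<inter> space M) * prob (Z -` S' \<inter> space M)"
    using indep_setD[OF indep[unfolded indep_rv_def] 1 2] by (simp only: eq)
  moreover have "(\<lambda>\<omega>. (h (Y \<omega>), Z \<omega>)) -` (S \<times> S') \<inter> space M
      = ((\<lambda>\<omega>. h (Y \<omega>)) -` S \<inter> space M) \<inter> (Z -` S' \<inter> space M)" by auto
  ultimately show "emeasure (distr M L (\<lambda>\<omega>. h (Y \<omega>))) S * emeasure (distr M N' Z) S'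
      = emeasure (distr M (L \<Otimes>\<^sub>M N') (\<lambda>\<omega>. (h (Y \<omega>), Z \<omega>))) (S \<times> S')"
    by (simp add: emeasure_distr emeasure_eq_measure ennreal_mult)
qed simp

lemma failure_bound:
  fixes T :: nat and \<epsilon> \<eta> \<mu> \<Delta> c :: real
  assumes pos: "\<epsilon> > 0" "\<eta> > 0" "\<mu> > 0" "\<Delta> > 0"
    and T: "real T = 4 / (\<eta> * \<mu>) * ln (120 * \<Delta> / \<epsilon>)"
    and tolerance: "\<epsilon> * ln (120 * \<Delta> / \<epsilon>) < 12 * \<Delta>"
    and rate: "\<eta> * \<mu> / 2 \<le> 1" and c: "c \<le> 7 / 480 * (\<eta> * \<mu> * \<epsilon>)"
  shows "(\<Delta> + T * c) / (10 * \<Delta>) + ((1 - \<eta> * \<mu> / 2) ^ T * \<Delta> + c / (\<eta> * \<mu> / 2)) / \<epsilon> \<le> 1 / 4"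
proof -
  define L where "L = ln (120 * \<Delta> / \<epsilon>)"
  define a where "a = \<eta> * \<mu>"
  have a: "a > 0" using pos by (simp add: a_def)
  have TL: "a * real T = 4 * L" using T a by (simp add: L_def[symmetric] a_def[symmetric])
  have "0 \<le> a * real T" using a by simp
  then have L: "L \<ge> 0" using TL by simp
  have "real T * c \<le> real T * (7 / 480 * (a * \<epsilon>))"
    using c by (intro mult_left_mono) (auto simp: a_def)
  also have "\<dots> = 7 / 480 * (a * real T) * \<epsilon>" by simp
  also have "\<dots> = 7 / 120 * (\<epsilon> * L)" by (simp add: TL)
  also have "\<dots> \<le> 7 / 120 * (12 * \<Delta>)" using tolerance by (intro mult_left_mono) (auto simp: L_def)
  finally have "\<Delta> + real T * c \<le> 17 / 10 * \<Delta>" by simp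
  then have 1: "(\<Delta> + real T * c) / (10 * \<Delta>) \<le> 17 / 100" using pos by (simp add: field_simps)
  have "(1 - a / 2) ^ T \<le> exp (- (a / 2)) ^ T"
    using rate exp_ge_add_one_self[of "- (a / 2)"] by (intro power_mono) (auto simp: a_def)
  also have "\<dots> = exp (- (a * real T) / 2)" by (simp add: exp_of_nat_mult[symmetric] mult_ac)
  \<comment> \<open>The exponent is \<open>- 2 * L\<close>; half of it already brings the initial
    gap down to \<open>\<epsilon> / 120\<close>.\<close>
  also have "\<dots> \<le> exp (- L)" using TL L by simp
  also have "\<dots> = \<epsilon> / (120 * \<Delta>)" using pos by (simp add: L_def exp_minus)
  finally have "(1 - a / 2) ^ T * \<Delta> \<le> \<epsilon> / 120" using pos by (simp add: field_simps)
  moreover have "c / (a / 2) \<le> 7 / 240 * \<epsilon>" using c a by (simp add: field_simps a_def[symmetric])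
  ultimately have "((1 - a / 2) ^ T * \<Delta> + c / (a / 2)) / \<epsilon> \<le> (\<epsilon> / 120 + 7 / 240 * \<epsilon>) / \<epsilon>"
    using pos by (intro divide_right_mono add_mono) auto
  also have "\<dots> = 9 / 240" using pos by simp
  finally show ?thesis using 1 unfolding a_def by linarith
qed

lemma bounded_bilinear_matrix_vector_mult:
  "bounded_bilinear ((*v) :: real^'n^'m \<Rightarrow> real^'n \<Rightarrow> real^'m)"
  unfolding bilinear_conv_bounded_bilinear[symmetric]
  by (auto simp: bilinear_def vec_eq_iff matrix_vector_mult_def sum.distrib algebra_simps
      sum_distrib_left intro!: linearI)

lemma measurable_quadratic_form [measurable]:
  "(\<lambda>(P, x). x \<bullet> (P *v x)) \<in> borel_measurable ((borel :: (real^'n^'n) measure) \<Otimes>\<^sub>M borel)"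
proof -
  have "continuous_on UNIV (\<lambda>p :: (real^'n^'n) \<times> (real^'n). snd p \<bullet> (fst p *v snd p))"
    by (intro continuous_on_inner continuous_on_snd continuous_on_fst continuous_on_id
        bounded_bilinear.continuous_on[OF bounded_bilinear_matrix_vector_mult])
  then show ?thesis
    by (simp add: borel_prod case_prod_beta' borel_measurable_continuous_onI)
qed

text \<open>Collects what both estimators share. \<open>r \<le> \<rho>0\<close> keeps queries from
  \<open>G0\<close> within reach of \<open>near\<close>; \<open>\<Delta>0 > 0\<close> is later
  derived from \<open>T > 0\<close> and the tolerance condition.\<close>

locale lqr_setting =
  fixes A :: "real^'n^'n" and B :: "real^'m^'n" and Q :: "real^'n^'n" and R :: "real^'m^'m"
    and \<D> :: "(real^'n) measure" and Cm :: real
    and Jx :: "real^'n^'m \<Rightarrow> real^'n \<Rightarrow> ereal" and J :: "real^'n^'m \<Rightarrow> ereal"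
    and Kst G0 :: "(real^'n^'m) set" and K0 Kopt :: "real^'n^'m"
    and lam \<zeta> \<phi> \<beta> :: "real^'n^'m \<Rightarrow> real"
    and \<mu> \<Delta>0 \<phi>0 \<rho>0 r :: real
  assumes law: "initial_law \<D> Cm"
    and Kst_def: "Kst = stabilizing A B"
    and Jx_def: "Jx = traj_cost A B Q R"
    and J_def: "J = lqr_cost A B Q R \<D>"
    and Kopt: "Kopt \<in> Kst" "\<forall>K'\<in>Kst. K' \<noteq> Kopt \<longrightarrow> J Kopt < J K'"
    and K0: "K0 \<in> Kst"
    and Delta0_def: "\<Delta>0 = real_of_ereal (J K0 - J Kopt)"
    and G0_def: "G0 = {K'. J K' - J Kopt \<le> ereal (10 * \<Delta>0)}"
    and pos: "\<forall>K'\<in>Kst. \<zeta> K' > 0 \<and> \<phi> K' > 0 \<and> \<beta> K' > 0"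
    and Lipschitz: "\<forall>K1\<in>Kst. \<forall>K2. norm (K2 - K1) \<le> \<zeta> K1 \<longrightarrow>
          \<bar>J K2 - J K1\<bar> \<le> ereal (lam K1 * norm (K2 - K1))"
    and smooth: "\<forall>K1\<in>Kst. \<forall>K2\<in>Kst. norm (K2 - K1) \<le> \<beta> K1 \<longrightarrow>
          norm (gradient J K2 - gradient J K1) \<le> \<phi> K1 * norm (K2 - K1)"
    and gradient_domination: "\<mu> > 0"
          "\<forall>K'\<in>Kst. ereal \<mu> * (J K' - J Kopt) \<le> ereal ((norm (gradient J K'))\<^sup>2)"
    and phi0: "bdd_above (\<phi> ` G0)" "\<phi>0 = (SUP K'\<in>G0. \<phi> K')"
    and rho0: "\<rho>0 = (INF K'\<in>G0. min (\<beta> K') (\<zeta> K'))" "\<rho>0 > 0"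
    and Delta0_pos: "\<Delta>0 > 0"
    and r: "0 < r" "r \<le> \<rho>0"
begin

text \<open>The value 0 off \<open>Kst\<close> matches \<open>real_of_ereal \<infinity> = 0\<close>,
  so the formulas for \<open>j\<close> and \<open>jx\<close> hold at all gains and give
  measurability on the whole space.\<close>

definition P :: "real^'n^'m \<Rightarrow> real^'n^'n" where
  "P k = indicator Kst k *\<^sub>R cost_matrix A B Q R k"

definition j :: "real^'n^'m \<Rightarrow> real" where "j k = real_of_ereal (J k)"

definition jx :: "real^'n^'m \<Rightarrow> real^'n \<Rightarrow> real" where "jx k x = real_of_ereal (Jx k x)"

lemma J_Kst: "k \<in> Kst \<Longrightarrow> J k = ereal (trace (cost_matrix A B Q R k))"
  unfolding Kst_def J_def by (rule lqr_cost_eq[OF law])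

lemma J_infinite: "k \<notin> Kst \<Longrightarrow> J k = \<infinity>"
  unfolding Kst_def J_def by (simp add: lqr_cost_def)

lemma J_eq: "k \<in> Kst \<Longrightarrow> J k = ereal (j k)"
  by (simp add: j_def J_Kst)

lemma Jx_Kst: "k \<in> Kst \<Longrightarrow> Jx k x = ereal (x \<bullet> (cost_matrix A B Q R k *v x))"
  unfolding Kst_def Jx_def by (rule traj_cost_eq)

lemma Jx_infinite: "k \<notin> Kst \<Longrightarrow> Jx k x = \<infinity>"
  unfolding Kst_def Jx_def by (simp add: traj_cost_def)

lemma j_eq: "j k = trace (P k)"
  by (cases "k \<in> Kst") (simp_all add: j_def P_def J_Kst J_infinite trace_def)

lemma jx_eq: "jx k x = x \<bullet> (P k *v x)"
  by (cases "k \<in> Kst") (simp_all add: jx_def P_def Jx_Kst Jx_infinite)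

lemma integral_jx: "integrable \<D> (jx k)" "(\<integral>x. jx k x \<partial>\<D>) = j k"
  using integrable_quadratic_form[OF law] integral_quadratic_form[OF law]
  by (simp_all add: jx_eq[abs_def] j_eq)

text \<open>At a non-stabilizing \<open>k'\<close> the cost difference would be infinite, against
  the finite Lipschitz bound. Openness of \<open>Kst\<close> is read off from this instead of from
  continuity of the spectral radius.\<close>

lemma near_Kst:
  assumes "k \<in> Kst" "norm (k' - k) \<le> \<zeta> k"
  shows "k' \<in> Kst"
proof (rule ccontr)
  assume "k' \<notin> Kst"
  then have "\<bar>J k' - J k\<bar> = \<infinity>" using assms(1) by (simp add: J_infinite J_eq)
  moreover have "\<bar>J k' - J k\<bar> \<le> ereal (lam k * norm (k' - k))" using Lipschitz assms by blast
  ultimately show False by simp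
qed

lemma open_Kst: "open Kst"
  unfolding open_contains_ball
proof
  fix k assume k: "k \<in> Kst"
  then have "ball k (\<zeta> k) \<subseteq> Kst"
    using near_Kst[OF k] by (auto simp: dist_norm norm_minus_commute)
  then show "\<exists>e>0. ball k e \<subseteq> Kst" using pos k by blast
qed

lemma measurable_Kst [measurable]: "Kst \<in> sets borel"
  using open_Kst by simp

lemma measurable_P [measurable]: "P \<in> borel_measurable borel"
proof -
  have "continuous_on Kst (cost_matrix A B Q R)"
    using cost_matrix_differentiable open_Kst
    by (intro continuous_at_imp_continuous_on ballI differentiable_imp_continuous_within)
      (auto simp: Kst_def)
  then show ?thesis unfolding P_def by (intro borel_measurable_continuous_on_indicator) auto
qed

lemma measurable_j [measurable]: "j \<in> borel_measurable borel"
proof -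
  have "continuous_on UNIV (trace :: real^'n^'n \<Rightarrow> real)"
    unfolding trace_def by (intro continuous_intros continuous_on_component)
  then have [measurable]: "(trace :: real^'n^'n \<Rightarrow> real) \<in> borel_measurable borel"
    by (rule borel_measurable_continuous_onI)
  show ?thesis unfolding j_eq[abs_def] by measurable
qed

lemma measurable_jx [measurable]: "case_prod jx \<in> borel_measurable (borel \<Otimes>\<^sub>M borel)"
  unfolding jx_eq by measurable

lemma Delta0: "\<Delta>0 = j K0 - j Kopt"
  using K0 Kopt(1) by (simp add: Delta0_def J_eq)

lemma G0_eq: "G0 = {k \<in> Kst. j k - j Kopt \<le> 10 * \<Delta>0}"
proof -
  have "J k - J Kopt \<le> ereal (10 * \<Delta>0) \<longleftrightarrow> k \<in> Kst \<and> j k - j Kopt \<le> 10 * \<Delta>0" for k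
    using Kopt(1) by (cases "k \<in> Kst") (auto simp: J_eq J_infinite)
  then show ?thesis by (auto simp: G0_def)
qed

lemma phi_le: "k \<in> G0 \<Longrightarrow> \<phi> k \<le> \<phi>0"
  unfolding phi0(2) by (rule cSUP_upper[OF _ phi0(1)])

lemma rho_le: "k \<in> G0 \<Longrightarrow> \<rho>0 \<le> \<beta> k \<and> \<rho>0 \<le> \<zeta> k"
proof -
  assume k: "k \<in> G0"
  have "bdd_below ((\<lambda>K'. min (\<beta> K') (\<zeta> K')) ` G0)"
    using pos by (intro bdd_belowI2[where m = 0]) (auto simp: G0_eq less_imp_le)
  from cINF_lower[OF this k] show ?thesis by (simp add: rho0(1))
qed

sublocale gradient_dominated j "gradient J" Kst G0 Kopt \<mu> \<phi>0 \<rho>0 \<Delta>0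
proof
  fix k assume k: "k \<in> Kst"
  have "GDERIV (\<lambda>k. real_of_ereal (J k)) k :> gradient J k"
    unfolding J_def
    by (rule lqr_cost_GDERIV[OF law]) (use open_Kst k in \<open>simp_all only: Kst_def\<close>)
  then show "GDERIV j k :> gradient J k" unfolding j_def[abs_def] .
  show "\<mu> * (j k - j Kopt) \<le> (norm (gradient J k))\<^sup>2"
    using gradient_domination(2) k Kopt(1) by (auto simp: J_eq)
  show "j Kopt < j k" if "k \<noteq> Kopt"
    using Kopt k that by (auto simp: J_eq)
next
  fix k k' assume k: "k \<in> G0" and n: "norm (k' - k) \<le> \<rho>0"
  have kst: "k \<in> Kst" using k by (simp add: G0_eq)
  have k': "k' \<in> Kst" using near_Kst[OF kst, of k'] rho_le[OF k] n by simp
  then have "norm (gradient J k' - gradient J k) \<le> \<phi> k * norm (k' - k)"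
    using smooth kst rho_le[OF k] n by auto
  also have "\<dots> \<le> \<phi>0 * norm (k' - k)" by (intro mult_right_mono phi_le k) simp
  finally show "k' \<in> Kst \<and> norm (gradient J k' - gradient J k) \<le> \<phi>0 * norm (k' - k)"
    using k' by blast
next
  have "Kopt \<in> G0" using Kopt(1) Delta0_pos by (simp add: G0_eq)
  with phi_le[OF this] pos Kopt(1) show "\<phi>0 > 0" by (meson less_le_trans)
qed (use G0_eq Kopt(1) gradient_domination(1) rho0(2) Delta0_pos in auto)

lemma measurable_G0 [measurable]: "G0 \<in> sets borel"
  unfolding G0_eq by measurable

text \<open>Smoothness with a uniform constant is available only around points of \<open>G0\<close>,
  so continuity, and with it measurability, is established on \<open>G0\<close>.\<close>

lemma measurable_gradient [measurable]:
  "(\<lambda>k. indicator G0 k *\<^sub>R gradient J k) \<in> borel_measurable borel"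
proof -
  have "continuous_on G0 (gradient J)"
    unfolding continuous_on_iff
  proof (intro ballI allI impI)
    fix k and e :: real assume k: "k \<in> G0" and e: "e > 0"
    show "\<exists>c>0. \<forall>k'\<in>G0. dist k' k < c \<longrightarrow> dist (gradient J k') (gradient J k) < e"
    proof (intro exI[of _ "min \<rho>0 (e / \<phi>0)"] conjI ballI impI)
      fix k' assume d: "dist k' k < min \<rho>0 (e / \<phi>0)"
      then have "norm (gradient J k' - gradient J k) \<le> \<phi>0 * norm (k' - k)"
        using near[OF k, of k'] by (simp add: dist_norm)
      also have "\<dots> < e" using d positive by (simp add: dist_norm field_simps)
      finally show "dist (gradient J k') (gradient J k) < e" by (simp add: dist_norm)
    qed (use e positive in auto)
  qed
  then show ?thesis by (intro borel_measurable_continuous_on_indicator) auto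
qed

section \<open>The law of one draw and the mean of an estimate\<close>

definition N :: "((real^'n^'m) \<times> (real^'n)) measure" where "N = unif_sphere \<Otimes>\<^sub>M \<D>"

definition G :: "estimator \<Rightarrow> real^'n^'m \<Rightarrow> (real^'n^'m) \<times> (real^'n) \<Rightarrow> real^'n^'m" where
  "G est k y = grad_est est Jx r k (fst y) (snd y)"

lemma G_One_Point: "G One_Point k y = (jx (k + r *\<^sub>R fst y) (snd y) * (real (CARD('m) * CARD('n)) / r)) *\<^sub>R fst y"
  by (simp add: G_def jx_def)

lemma G_Two_Point: "G Two_Point k y =
    ((jx (k + r *\<^sub>R fst y) (snd y) - jx (k - r *\<^sub>R fst y) (snd y)) * (real (CARD('m) * CARD('n)) / (2 * r))) *\<^sub>R fst y"
  by (simp add: G_def jx_def)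

lemma sets_law [simp, measurable_cong]: "sets \<D> = sets borel"
  using law by (simp add: initial_law_def)

lemma space_law [simp]: "space \<D> = UNIV"
  using sets_eq_imp_space_eq[OF sets_law] by simp

lemma sets_N [measurable_cong]: "sets N = sets (borel \<Otimes>\<^sub>M borel)"
  unfolding N_def by (rule sets_pair_measure_cong) simp_all

lemma sets_N_borel: "sets N = sets borel"
  unfolding sets_N borel_prod ..

lemma prob_space_law: "prob_space \<D>"
  using law by (simp add: initial_law_def)

lemma pair_prob_space_N: "pair_prob_space (unif_sphere :: (real^'n^'m) measure) \<D>"
proof -
  interpret U: prob_space "unif_sphere :: (real^'n^'m) measure" by (rule prob_space_unif_sphere)
  interpret L: prob_space \<D> by (rule prob_space_law)
  show ?thesis ..
qed

lemma prob_space_N: "prob_space N"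
proof -
  interpret LN: pair_prob_space "unif_sphere :: (real^'n^'m) measure" \<D> by (rule pair_prob_space_N)
  show ?thesis unfolding N_def by (rule LN.prob_space_axioms)
qed

lemma measurable_G [measurable]: "case_prod (G est) \<in> borel_measurable (borel \<Otimes>\<^sub>M N)"
  by (cases est) (simp_all add: G_One_Point G_Two_Point case_prod_beta')

lemma AE_G_le:
  assumes "est_sup (grad_est est Jx r) \<D> G0 \<le> ereal g" "k \<in> G0"
  shows "AE y in N. norm (G est k y) \<le> g"
proof -
  let ?f = "\<lambda>(D, x0). ereal (norm (grad_est est Jx r k D x0))"
  have le: "esssup N ?f \<le> ereal g"
    using assms by (intro order_trans[OF _ assms(1)]) (auto simp: est_sup_def N_def intro: SUP_upper)
  have "AE y in N. ?f y \<le> esssup N ?f" by (rule esssup_AE)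
  then show ?thesis
  proof eventually_elim
    case (elim y)
    then have "?f y \<le> ereal g" using le by (rule order_trans)
    then have "ereal (norm (G est k y)) \<le> ereal g" by (simp add: G_def case_prod_beta')
    then show ?case by simp
  qed
qed

text \<open>The estimates are linear in the cost, so averaging over the initial state first replaces
  \<open>jx\<close> by \<open>j\<close>; what remains is the spherical mean of
  \<open>sphere_estimate\<close>.\<close>

lemma G_bias:
  assumes k: "k \<in> G0" and int: "integrable N (G est k)"
  shows "norm ((\<integral>y. G est k y \<partial>N) - gradient J k) \<le> \<phi>0 * r"
proof -
  interpret LN: pair_prob_space "unif_sphere :: (real^'n^'m) measure" \<D> by (rule pair_prob_space_N)
  interpret sphere_estimate j k "gradient J k" r "\<phi>0 * r"
    using r near_linear[OF k r(2)] by unfold_locales auto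
  have dim: "real (CARD('m) * CARD('n)) = DIM(real^'n^'m)" by simp
  have "(\<integral>y. G est k y \<partial>N) = (\<integral>D. \<integral>x. G est k (D, x) \<partial>\<D> \<partial>unif_sphere)"
    using LN.integral_fst'[OF int[unfolded N_def]] by (simp add: N_def)
  also have "\<dots> = (\<integral>D. (j (k + r *\<^sub>R D) * (real (CARD('m) * CARD('n)) / r)) *\<^sub>R D \<partial>unif_sphere)"
  proof (cases est)
    case One_Point
    then show ?thesis by (simp add: G_One_Point integral_jx)
  next
    case Two_Point
    then show ?thesis
      using two_point_eq_one_point
      by (simp add: G_Two_Point integral_jx Bochner_Integration.integral_diff[OF integral_jx(1) integral_jx(1)])
  qed
  finally show ?thesis using one_point_bias by (simp add: dim)
qed

text \<open>The recursion is imposed only while queried costs are finite. Queries lie at distance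
  \<open>r \<le> \<rho>0\<close> from the iterate, so this is automatic while the iterates stay in
  \<open>G0\<close>.\<close>

lemma queries_in_Kst:
  assumes "k \<in> G0" "norm D = 1" "k' \<in> queries est r k D"
  shows "k' \<in> Kst"
proof -
  have "norm (k' - k) \<le> \<rho>0" using assms(2,3) r by (cases est) auto
  then show ?thesis using near[OF assms(1)] by blast
qed

lemma success:
  fixes M :: "'w measure" and T :: nat
  assumes run: "perturbed_iteration M est Jx \<D> \<eta> r T K0 D X E K"
    and sup: "est_sup (grad_est est Jx r) \<D> G0 \<le> ereal ginf"
    and var: "est_var (grad_est est Jx r) \<D> G0 \<le> ennreal g2" "g2 \<ge> 0"
    and E: "\<forall>s<T. AE \<omega> in M. norm (E s \<omega>) \<le> \<delta>"
    and stepsize: "\<eta> > 0" "\<eta> \<le> 1 / (4 * \<phi>0)" "\<eta> * (ginf + \<delta>) \<le> \<rho>0"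
    and \<epsilon>: "\<epsilon> > 0" "\<epsilon> * ln (120 * \<Delta>0 / \<epsilon>) < 12 * \<Delta>0"
    and T: "real T = 4 / (\<eta> * \<mu>) * ln (120 * \<Delta>0 / \<epsilon>)"
    and noise: "\<eta> * \<phi>0 * g2 \<le> \<mu> * \<epsilon> / 480" "(\<phi>0 * r)\<^sup>2 \<le> \<mu> * \<epsilon> / 240" "\<delta>\<^sup>2 \<le> \<mu> * \<epsilon> / 120"
  shows "measure M {\<omega> \<in> space M. J (K T \<omega>) - J Kopt < ereal \<epsilon>} \<ge> 3 / 4"
proof -
  interpret M: prob_space M using run by (simp add: perturbed_iteration_def)
  interpret N: prob_space N by (rule prob_space_N)
  define W where "W s \<omega> = (D s \<omega>, X s \<omega>)" for s \<omega>
  have D [measurable]: "D s \<in> borel_measurable M" and X [measurable]: "X s \<in> borel_measurable M"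
    and Em [measurable]: "E s \<in> borel_measurable M" if "s < T" for s
    using run that by (auto simp: perturbed_iteration_def)
  have K [measurable]: "K s \<in> borel_measurable M" if "s \<le> T" for s
    using run that by (auto simp: perturbed_iteration_def)
  have init: "K 0 \<omega> = K0" if "\<omega> \<in> space M" for \<omega>
    using run that by (simp add: perturbed_iteration_def)
  have laws: "distr M borel (D s) = unif_sphere" "distr M borel (X s) = \<D>" if "s < T" for s
    using run that by (auto simp: perturbed_iteration_def)
  have W: "W s \<in> measurable M N" if "s < T" for s
    unfolding W_def using that by measurable
  have W_law: "distr M N (W s) = N" if s: "s < T" for s
  proof -
    have "indep_rv M borel (D s) borel (X s)" using run s by (simp add: perturbed_iteration_def)
    from M.indep_rv_distr_pair[OF this D[OF s] X[OF s], of "\<lambda>x. x" borel]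
    have "distr M (borel \<Otimes>\<^sub>M borel) (W s) = N"
      by (simp add: laws[OF s] N_def W_def[abs_def])
    moreover have "distr M (borel \<Otimes>\<^sub>M borel) (W s) = distr M N (W s)"
      by (rule distr_cong[OF refl sets_N[symmetric] refl])
    ultimately show ?thesis by simp
  qed
  have fresh: "distr M (borel \<Otimes>\<^sub>M N) (\<lambda>\<omega>. (stopped G0 Kopt K s \<omega>, W s \<omega>))
      = distr M borel (stopped G0 Kopt K s) \<Otimes>\<^sub>M N" if s: "s < T" for s
  proof -
    define past where "past \<omega> = (\<lambda>i\<in>{..<s}. (D i \<omega>, X i \<omega>, E i \<omega>, K (Suc i) \<omega>))" for \<omega>
    \<comment> \<open>Reads iterate \<open>i\<close> from the recorded past: entry
      \<open>i - 1\<close> stores \<open>K (Suc (i - 1))\<close>, and time 0 is not recorded but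
      constant. The stopped iterate thus becomes a function of the past alone.\<close>
    define k where "k i z = (if i = 0 then K0 else snd (snd (snd (z (i - 1)))))"
      for i and z :: "nat \<Rightarrow> (real^'n^'m) \<times> (real^'n) \<times> (real^'n^'m) \<times> (real^'n^'m)"
    let ?Z = "Pi\<^sub>M {..<s} (\<lambda>_. borel)
      :: (nat \<Rightarrow> (real^'n^'m) \<times> (real^'n) \<times> (real^'n^'m) \<times> (real^'n^'m)) measure"
    have "indep_rv M ?Z past borel (\<lambda>\<omega>. (D s \<omega>, X s \<omega>))"
      using run s by (simp add: perturbed_iteration_def past_def[abs_def])
    then have indep: "indep_rv M ?Z past borel (W s)" by (simp add: W_def[abs_def])
    have past: "past \<in> measurable M ?Z"
      unfolding past_def using s by (intro measurable_restrict borel_measurable_Pair) auto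
    have Wb: "W s \<in> measurable M borel"
      using measurable_cong_sets[OF refl sets_N_borel, of M] W[OF s] by simp
    have h: "stopped G0 Kopt k s \<in> measurable ?Z borel"
    proof (rule measurable_stopped[OF _ measurable_G0])
      fix i assume i: "i \<le> s"
      have snd3: "(\<lambda>y. snd (snd (snd y)))
          \<in> borel_measurable (borel :: ((real^'n^'m) \<times> (real^'n) \<times> (real^'n^'m) \<times> (real^'n^'m)) measure)"
        by (intro borel_measurable_continuous_onI continuous_intros)
      show "k i \<in> measurable ?Z borel"
      proof (cases "i = 0")
        case False
        then have "(\<lambda>z. z (i - 1)) \<in> measurable ?Z borel"
          using i by (intro measurable_component_singleton) auto
        from measurable_compose[OF this snd3] False show ?thesis by (simp add: k_def[abs_def])
      qed (simp add: k_def[abs_def])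
    qed
    have eq: "stopped G0 Kopt k s (past \<omega>) = stopped G0 Kopt K s \<omega>" if "\<omega> \<in> space M" for \<omega>
    proof -
      have "k i (past \<omega>) = K i \<omega>" if "i \<le> s" for i
        using that init[OF \<open>\<omega> \<in> space M\<close>] by (cases i) (auto simp: k_def past_def)
      then show ?thesis by (auto simp: stopped_def stays_def)
    qed
    have "distr M (borel \<Otimes>\<^sub>M N) (\<lambda>\<omega>. (stopped G0 Kopt K s \<omega>, W s \<omega>))
        = distr M (borel \<Otimes>\<^sub>M borel) (\<lambda>\<omega>. (stopped G0 Kopt k s (past \<omega>), W s \<omega>))"
      by (rule distr_cong[OF refl sets_pair_measure_cong[OF refl sets_N_borel]]) (simp add: eq)
    also have "\<dots> = distr M borel (\<lambda>\<omega>. stopped G0 Kopt k s (past \<omega>)) \<Otimes>\<^sub>M distr M borel (W s)"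
      by (rule M.indep_rv_distr_pair[OF indep past Wb h])
    also have "distr M borel (\<lambda>\<omega>. stopped G0 Kopt k s (past \<omega>)) = distr M borel (stopped G0 Kopt K s)"
      by (rule distr_cong) (auto simp: eq)
    also have "distr M borel (W s) = distr M N (W s)"
      by (rule distr_cong[OF refl sets_N_borel[symmetric] refl])
    finally show ?thesis by (simp add: W_law[OF s])
  qed
  have recursion: "AE \<omega> in M. stays G0 K s \<omega> \<longrightarrow>
      K (Suc s) \<omega> = K s \<omega> - \<eta> *\<^sub>R G est (K s \<omega>) (W s \<omega>) + \<eta> *\<^sub>R E s \<omega>" if s: "s < T" for s
  proof -
    have "AE \<omega> in M. norm (D i \<omega>) = 1" if "i < T" for i
    proof -
      have "AE k in distr M borel (D i). norm k = 1"
        unfolding laws(1)[OF that] by (rule AE_unif_sphere_norm)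
      then show ?thesis using D[OF that] by (subst (asm) AE_distr_iff) auto
    qed
    \<comment> \<open>The recursion at step \<open>s\<close> presupposes finite costs at all steps
      up to \<open>s\<close>, so unit length is needed for all these directions at once.\<close>
    then have "AE \<omega> in M. \<forall>i\<in>{..s}. norm (D i \<omega>) = 1"
      using s by (intro AE_finite_allI) auto
    moreover have "AE \<omega> in M. (\<forall>i\<le>s. \<forall>k\<in>queries est r (K i \<omega>) (D i \<omega>). Jx k (X i \<omega>) \<noteq> \<infinity>) \<longrightarrow>
        K (Suc s) \<omega> = K s \<omega> - \<eta> *\<^sub>R grad_est est Jx r (K s \<omega>) (D s \<omega>) (X s \<omega>) + \<eta> *\<^sub>R E s \<omega>"
      using run s by (simp add: perturbed_iteration_def)
    ultimately show ?thesis
    proof eventually_elim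
      case (elim \<omega>)
      show ?case
      proof
        assume stay: "stays G0 K s \<omega>"
        have "Jx k (X i \<omega>) \<noteq> \<infinity>" if "i \<le> s" "k \<in> queries est r (K i \<omega>) (D i \<omega>)" for i k
          using queries_in_Kst[of "K i \<omega>" "D i \<omega>" k] stay elim(1) that
          by (simp add: stays_def Jx_Kst)
        with elim(2) show "K (Suc s) \<omega> = K s \<omega> - \<eta> *\<^sub>R G est (K s \<omega>) (W s \<omega>) + \<eta> *\<^sub>R E s \<omega>"
          by (simp add: G_def W_def)
      qed
    qed
  qed
  have var': "(\<integral>\<^sup>+y. ennreal ((norm (G est k y - (\<integral>y. G est k y \<partial>N)))\<^sup>2) \<partial>N) \<le> ennreal g2"
    if "k \<in> G0" for k
  proof -
    have "(\<integral>\<^sup>+y. ennreal ((norm (G est k y - (\<integral>y. G est k y \<partial>N)))\<^sup>2) \<partial>N)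
        \<le> est_var (grad_est est Jx r) \<D> G0"
      unfolding est_var_def N_def G_def case_prod_beta' using that
      by (rule SUP_upper)
    with var(1) show ?thesis by simp
  qed
  have int: "integrable N (G est k)" if "k \<in> G0" for k
    by (rule N.integrable_const_bound[OF AE_G_le[OF sup that]]) measurable
  interpret perturbed_descent j "gradient J" Kst G0 Kopt \<mu> \<phi>0 \<rho>0 \<Delta>0 M N "G est" K W E K0 T \<eta>
    "\<phi>0 * r" \<delta> ginf g2
  proof unfold_locales
    show "K0 \<in> G0" using K0 Delta0 Delta0_pos by (simp add: G0_eq)
    show "norm ((\<integral>y. G est k y \<partial>N) - gradient J k) \<le> \<phi>0 * r" if "k \<in> G0" for k
      using that int[OF that] by (rule G_bias)
    show "AE \<omega> in M. norm (E s \<omega>) \<le> \<delta>" if "s < T" for s using E that by blast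
  qed (fact measurable_Kst measurable_G0 measurable_gradient measurable_j measurable_G K W
      AE_G_le[OF sup] var' var(2) fresh init recursion stepsize Delta0[symmetric])+
  have "drift \<le> 7 / 480 * (\<eta> * \<mu> * \<epsilon>)"
  proof -
    \<comment> \<open>Yields \<open>(x + y)\<^sup>2 \<le> 2 * x\<^sup>2 + 2 * y\<^sup>2\<close>; the
      bounds for bias and perturbation then add up to 2/240 + 2/120 = 1/40 of
      \<open>\<mu> * \<epsilon>\<close>.\<close>
    have "0 \<le> (\<phi>0 * r - \<delta>)\<^sup>2" by simp
    then have "(\<phi>0 * r + \<delta>)\<^sup>2 \<le> 2 * (\<phi>0 * r)\<^sup>2 + 2 * \<delta>\<^sup>2" by (simp add: power2_eq_square algebra_simps)
    also have "\<dots> \<le> \<mu> * \<epsilon> / 40" using noise by simp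
    finally have "\<eta> / 2 * (\<phi>0 * r + \<delta>)\<^sup>2 \<le> \<eta> / 2 * (\<mu> * \<epsilon> / 40)"
      using stepsize(1) by (intro mult_left_mono) auto
    moreover have "\<eta> * (\<eta> * \<phi>0 * g2) \<le> \<eta> * (\<mu> * \<epsilon> / 480)"
      using noise(1) stepsize(1) by (intro mult_left_mono) auto
    moreover have "drift = \<eta> / 2 * (\<phi>0 * r + \<delta>)\<^sup>2 + \<eta> * (\<eta> * \<phi>0 * g2)"
      by (simp add: drift_def power2_eq_square[of \<eta>])
    ultimately have "drift \<le> \<eta> / 2 * (\<mu> * \<epsilon> / 40) + \<eta> * (\<mu> * \<epsilon> / 480)" by linarith
    also have "\<dots> = 7 / 480 * (\<eta> * \<mu> * \<epsilon>)" by simp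
    finally show ?thesis .
  qed
  then have "(\<Delta>0 + T * drift) / (10 * \<Delta>0) + ((1 - \<eta> * \<mu> / 2) ^ T * \<Delta>0 + drift / (\<eta> * \<mu> / 2)) / \<epsilon> \<le> 1 / 4"
    using \<epsilon> T stepsize(1) positive rate_bounds by (intro failure_bound) auto
  then have "3 / 4 \<le> M.prob {\<omega> \<in> space M. K T \<omega> \<in> Kst \<and> j (K T \<omega>) - j Kopt < \<epsilon>}"
    using success_probability[OF \<epsilon>(1)] by linarith
  \<comment> \<open>An infinite cost has an infinite gap, so a gap below \<open>\<epsilon>\<close>
    already implies that the gain is stabilizing.\<close>
  moreover have "J k - J Kopt < ereal \<epsilon> \<longleftrightarrow> k \<in> Kst \<and> j k - j Kopt < \<epsilon>" for k
    using Kopt(1) by (cases "k \<in> Kst") (auto simp: J_eq J_infinite)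
  ultimately show ?thesis by simp
qed

end

theorem theorem1:
  fixes A :: "real^'n^'n" and B :: "real^'m^'n" and Q :: "real^'n^'n" and R :: "real^'m^'m"
    and \<D> :: "(real^'n) measure" and Cm :: real
    and Jx :: "real^'n^'m \<Rightarrow> real^'n \<Rightarrow> ereal" and J :: "real^'n^'m \<Rightarrow> ereal"
    and Kst G0 :: "(real^'n^'m) set" and K0 Kopt :: "real^'n^'m"
    and lam lamx \<zeta> \<phi> \<beta> :: "real^'n^'m \<Rightarrow> real"
    and \<mu> \<Delta>0 J0 \<phi>0 lam0 \<rho>0 \<theta>0 d \<eta> r \<delta> \<epsilon> :: real
    and M :: "'w measure" and T :: nat
    and D E K :: "nat \<Rightarrow> 'w \<Rightarrow> real^'n^'m" and X :: "nat \<Rightarrow> 'w \<Rightarrow> real^'n"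
  assumes system: "lqr_system A B Q R"
    and law: "initial_law \<D> Cm"
    and Kst_def: "Kst = stabilizing A B"
    and Jx_def: "Jx = traj_cost A B Q R"
    and J_def: "J = lqr_cost A B Q R \<D>"
    and d_def: "d = real (CARD('m) * CARD('n))"
    and Kopt: "Kopt \<in> Kst" "\<forall>K'\<in>Kst. K' \<noteq> Kopt \<longrightarrow> J Kopt < J K'"
    and K0: "K0 \<in> Kst"
    and J0_def: "J0 = real_of_ereal (J K0)"
    and Delta0_def: "\<Delta>0 = real_of_ereal (J K0 - J Kopt)"
    and G0_def: "G0 = {K'. J K' - J Kopt \<le> ereal (10 * \<Delta>0)}"
    and pos: "\<forall>K'\<in>Kst. lam K' > 0 \<and> lamx K' > 0 \<and> \<zeta> K' > 0 \<and> \<phi> K' > 0 \<and> \<beta> K' > 0"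
    and Lipschitz: "\<forall>K1\<in>Kst. \<forall>K2. norm (K2 - K1) \<le> \<zeta> K1 \<longrightarrow>
          \<bar>J K2 - J K1\<bar> \<le> ereal (lam K1 * norm (K2 - K1)) \<and>
          (AE x0 in \<D>. \<bar>Jx K2 x0 - Jx K1 x0\<bar> \<le> ereal (lamx K1 * norm (K2 - K1)))"
    and smooth: "\<forall>K1\<in>Kst. \<forall>K2\<in>Kst. norm (K2 - K1) \<le> \<beta> K1 \<longrightarrow>
          norm (gradient J K2 - gradient J K1) \<le> \<phi> K1 * norm (K2 - K1)"
    and gradient_domination: "\<mu> > 0"
          "\<forall>K'\<in>Kst. ereal \<mu> * (J K' - J Kopt) \<le> ereal ((norm (gradient J K'))\<^sup>2)"
    and phi0: "bdd_above (\<phi> ` G0)" "\<phi>0 = (SUP K'\<in>G0. \<phi> K')"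
    and lam0: "bdd_above (lam ` G0)" "lam0 = (SUP K'\<in>G0. lam K')"
    and rho0: "\<rho>0 = (INF K'\<in>G0. min (\<beta> K') (\<zeta> K'))" "\<rho>0 > 0"
    and theta0_def: "\<theta>0 = min (1 / (2 * \<phi>0)) (\<rho>0 / lam0)"
    and params: "\<eta> > 0" "r > 0" "\<delta> > 0" "\<epsilon> > 0"
    and tolerance: "\<epsilon> * ln (120 * \<Delta>0 / \<epsilon>) < 12 * \<Delta>0"
    and T: "real T = 4 / (\<eta> * \<mu>) * ln (120 * \<Delta>0 / \<epsilon>)" "T > 0"
    and perturbation: "\<forall>s<T. AE \<omega> in M. norm (E s \<omega>) \<le> \<delta>"
  shows
    "(perturbed_iteration M One_Point Jx \<D> \<eta> r T K0 D X E K \<and>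
      (r \<le> Min {10 * J0 / lam0, \<rho>0} \<longrightarrow>
        est_var (grad_est One_Point Jx r) \<D> G0 \<le> ennreal ((20 * Cm * J0 * d / r)\<^sup>2) \<and>
        est_sup (grad_est One_Point Jx r) \<D> G0 \<le> ereal (20 * Cm * J0 * d / r)) \<and>
      \<eta> \<le> Min {\<mu> * r\<^sup>2 * \<epsilon> / (480 * \<phi>0 * (20 * Cm * J0 * d)\<^sup>2), 1 / (4 * \<phi>0),
               \<rho>0 * r / (20 * Cm * J0 * d + \<delta> * r)} \<and>
      r \<le> Min {\<mu> * \<theta>0 / (16 * \<phi>0) * sqrt (\<epsilon> / 15), 1 / (4 * \<phi>0) * sqrt (\<mu> * \<epsilon> / 15),
               \<rho>0, 10 * J0 / lam0} \<and>
      \<delta> \<le> Min {\<mu> * \<theta>0 / 16 * sqrt (\<epsilon> / 15), 1 / 2 * sqrt (\<mu> * \<epsilon> / 30)}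
      \<longrightarrow> measure M {\<omega> \<in> space M. J (K T \<omega>) - J Kopt < ereal \<epsilon>} \<ge> 3 / 4)
     \<and>
     (perturbed_iteration M Two_Point Jx \<D> \<eta> r T K0 D X E K \<and>
      (r \<le> \<rho>0 \<longrightarrow>
        est_var (grad_est Two_Point Jx r) \<D> G0 \<le> ennreal (d * lam0\<^sup>2) \<and>
        est_sup (grad_est Two_Point Jx r) \<D> G0 \<le> ereal (d * lam0)) \<and>
      \<eta> \<le> Min {\<mu> * \<epsilon> / (480 * \<phi>0 * d * lam0\<^sup>2), 1 / (4 * \<phi>0), \<rho>0 / (d * lam0 + \<delta>)} \<and>
      r \<le> Min {\<mu> * \<theta>0 / (16 * \<phi>0) * sqrt (\<epsilon> / 15), 1 / (4 * \<phi>0) * sqrt (\<mu> * \<epsilon> / 15),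
               \<rho>0} \<and>
      \<delta> \<le> Min {\<mu> * \<theta>0 / 16 * sqrt (\<epsilon> / 15), 1 / 2 * sqrt (\<mu> * \<epsilon> / 30)}
      \<longrightarrow> measure M {\<omega> \<in> space M. J (K T \<omega>) - J Kopt < ereal \<epsilon>} \<ge> 3 / 4)"
proof -
  \<comment> \<open>\<open>T\<close> is positive, hence so is the logarithm, and the tolerance
    condition then forces \<open>\<Delta>0 > 0\<close>.\<close>
  have ln_pos: "ln (120 * \<Delta>0 / \<epsilon>) > 0"
  proof (rule ccontr)
    assume "\<not> ln (120 * \<Delta>0 / \<epsilon>) > 0"
    then have "4 / (\<eta> * \<mu>) * ln (120 * \<Delta>0 / \<epsilon>) \<le> 0"
      using params(1) gradient_domination(1) by (intro mult_nonneg_nonpos) auto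
    then show False using T by linarith
  qed
  then have "0 < \<epsilon> * ln (120 * \<Delta>0 / \<epsilon>)" using params(4) by simp
  then have Delta0: "\<Delta>0 > 0" using tolerance by linarith
  have setting: "lqr_setting A B Q R \<D> Cm Jx J Kst G0 K0 Kopt lam \<zeta> \<phi> \<beta> \<mu> \<Delta>0 \<phi>0 \<rho>0 r"
    if "r \<le> \<rho>0"
    using assms that Delta0 unfolding lqr_setting_def by blast
  have conclude: "measure M {\<omega> \<in> space M. J (K T \<omega>) - J Kopt < ereal \<epsilon>} \<ge> 3 / 4"
    if run: "perturbed_iteration M est Jx \<D> \<eta> r T K0 D X E K"
      and sup: "est_sup (grad_est est Jx r) \<D> G0 \<le> ereal ginf"
      and var: "est_var (grad_est est Jx r) \<D> G0 \<le> ennreal g2" "g2 \<ge> 0"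
      and step: "\<eta> \<le> 1 / (4 * \<phi>0)" "\<eta> * (ginf + \<delta>) \<le> \<rho>0" "\<eta> * \<phi>0 * g2 \<le> \<mu> * \<epsilon> / 480"
      and radius: "r \<le> \<rho>0" "r \<le> 1 / (4 * \<phi>0) * sqrt (\<mu> * \<epsilon> / 15)"
      and \<delta>: "\<delta> \<le> 1 / 2 * sqrt (\<mu> * \<epsilon> / 30)"
    for est and ginf g2 :: real
  proof -
    interpret lqr_setting A B Q R \<D> Cm Jx J Kst G0 K0 Kopt lam \<zeta> \<phi> \<beta> \<mu> \<Delta>0 \<phi>0 \<rho>0 r
      by (rule setting[OF radius(1)])
    \<comment> \<open>Squaring gives 1/16 * 1/15 = 1/240 for the bias and, below, 1/4 * 1/30 = 1/120
      for the perturbation.\<close>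
    have "\<phi>0 * r \<le> 1 / 4 * sqrt (\<mu> * \<epsilon> / 15)" using radius(2) positive(2) by (simp add: field_simps)
    then have "(\<phi>0 * r)\<^sup>2 \<le> (1 / 4 * sqrt (\<mu> * \<epsilon> / 15))\<^sup>2"
      using positive(2) params(2) by (intro power_mono) auto
    then have bias: "(\<phi>0 * r)\<^sup>2 \<le> \<mu> * \<epsilon> / 240"
      using positive(1) params(4) by (simp add: power_mult_distrib power_divide)
    have "\<delta>\<^sup>2 \<le> (1 / 2 * sqrt (\<mu> * \<epsilon> / 30))\<^sup>2" using \<delta> params(3) by (intro power_mono) auto
    then have perturb: "\<delta>\<^sup>2 \<le> \<mu> * \<epsilon> / 120"
      using positive(1) params(4) by (simp add: power_mult_distrib power_divide)
    show ?thesis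
      by (rule success[OF run sup var perturbation params(1) step(1,2) params(4) tolerance T(1) step(3)
            bias perturb])
  qed
  show ?thesis
  proof (intro conjI impI; elim conjE)
    let ?c = "20 * Cm * J0 * d"
    assume run: "perturbed_iteration M One_Point Jx \<D> \<eta> r T K0 D X E K"
      and est: "r \<le> Min {10 * J0 / lam0, \<rho>0} \<longrightarrow>
        est_var (grad_est One_Point Jx r) \<D> G0 \<le> ennreal ((?c / r)\<^sup>2) \<and>
        est_sup (grad_est One_Point Jx r) \<D> G0 \<le> ereal (?c / r)"
      and \<eta>: "\<eta> \<le> Min {\<mu> * r\<^sup>2 * \<epsilon> / (480 * \<phi>0 * ?c\<^sup>2), 1 / (4 * \<phi>0), \<rho>0 * r / (?c + \<delta> * r)}"
      and r: "r \<le> Min {\<mu> * \<theta>0 / (16 * \<phi>0) * sqrt (\<epsilon> / 15), 1 / (4 * \<phi>0) * sqrt (\<mu> * \<epsilon> / 15),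
               \<rho>0, 10 * J0 / lam0}"
      and \<delta>: "\<delta> \<le> Min {\<mu> * \<theta>0 / 16 * sqrt (\<epsilon> / 15), 1 / 2 * sqrt (\<mu> * \<epsilon> / 30)}"
    have "\<eta> \<le> \<rho>0 * r / (?c + \<delta> * r)" using \<eta> by simp
    \<comment> \<open>A nonpositive denominator, zero included since \<open>x / 0 = 0\<close>, would
      make the quotient at most 0, against \<open>\<eta> > 0\<close>. The other denominators are
      treated in the same way.\<close>
    moreover from this params(1) have "?c + \<delta> * r > 0"
      using rho0(2) params(2) by (smt (verit) divide_nonneg_nonpos mult_pos_pos)
    ultimately have "\<eta> * (?c + \<delta> * r) \<le> \<rho>0 * r" by (simp add: pos_le_divide_eq)
    then have step: "\<eta> * (?c / r + \<delta>) \<le> \<rho>0" using params(2) by (simp add: field_simps)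
    have "\<eta> \<le> \<mu> * r\<^sup>2 * \<epsilon> / (480 * \<phi>0 * ?c\<^sup>2)" using \<eta> by simp
    moreover from this params(1) have "480 * \<phi>0 * ?c\<^sup>2 > 0"
      using gradient_domination(1) params(2,4)
      by (smt (verit) divide_nonneg_nonpos mult_pos_pos zero_less_power)
    ultimately have "\<eta> * (480 * \<phi>0 * ?c\<^sup>2) \<le> \<mu> * r\<^sup>2 * \<epsilon>" by (simp only: pos_le_divide_eq)
    then have noise: "\<eta> * \<phi>0 * (?c / r)\<^sup>2 \<le> \<mu> * \<epsilon> / 480"
      using params(2) by (simp add: power_divide field_simps)
    show "3 / 4 \<le> measure M {\<omega> \<in> space M. J (K T \<omega>) - J Kopt < ereal \<epsilon>}"
      using \<eta> r \<delta> est by (intro conclude[OF run _ _ _ _ step noise]) auto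
  next
    assume run: "perturbed_iteration M Two_Point Jx \<D> \<eta> r T K0 D X E K"
      and est: "r \<le> \<rho>0 \<longrightarrow>
        est_var (grad_est Two_Point Jx r) \<D> G0 \<le> ennreal (d * lam0\<^sup>2) \<and>
        est_sup (grad_est Two_Point Jx r) \<D> G0 \<le> ereal (d * lam0)"
      and \<eta>: "\<eta> \<le> Min {\<mu> * \<epsilon> / (480 * \<phi>0 * d * lam0\<^sup>2), 1 / (4 * \<phi>0), \<rho>0 / (d * lam0 + \<delta>)}"
      and r: "r \<le> Min {\<mu> * \<theta>0 / (16 * \<phi>0) * sqrt (\<epsilon> / 15), 1 / (4 * \<phi>0) * sqrt (\<mu> * \<epsilon> / 15), \<rho>0}"
      and \<delta>: "\<delta> \<le> Min {\<mu> * \<theta>0 / 16 * sqrt (\<epsilon> / 15), 1 / 2 * sqrt (\<mu> * \<epsilon> / 30)}"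
    have "\<eta> \<le> \<rho>0 / (d * lam0 + \<delta>)" using \<eta> by simp
    moreover from this params(1) have "d * lam0 + \<delta> > 0"
      using rho0(2) by (smt (verit) divide_nonneg_nonpos)
    ultimately have step: "\<eta> * (d * lam0 + \<delta>) \<le> \<rho>0" by (simp add: pos_le_divide_eq)
    have "\<eta> \<le> \<mu> * \<epsilon> / (480 * \<phi>0 * d * lam0\<^sup>2)" using \<eta> by simp
    moreover from this params(1) have "480 * \<phi>0 * d * lam0\<^sup>2 > 0"
      using gradient_domination(1) params(4) by (smt (verit) divide_nonneg_nonpos mult_pos_pos)
    ultimately have "\<eta> * (480 * \<phi>0 * d * lam0\<^sup>2) \<le> \<mu> * \<epsilon>" by (simp only: pos_le_divide_eq)
    then have noise: "\<eta> * \<phi>0 * (d * lam0\<^sup>2) \<le> \<mu> * \<epsilon> / 480" by (simp add: field_simps)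
    have "d * lam0\<^sup>2 \<ge> 0" by (simp add: d_def)
    then show "3 / 4 \<le> measure M {\<omega> \<in> space M. J (K T \<omega>) - J Kopt < ereal \<epsilon>}"
      using \<eta> r \<delta> est by (intro conclude[OF run _ _ _ _ step noise]) auto
  qed
qed

end
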